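(* Let $d\ge1$ and let $(\mathbb Z^d,E,\mu,w)$ be the weighted nearest-neighbour lattice graph with vertex measure $\mu(x)=\sum_{y\sim x}w_{xy}$, satisfying $0<\mu_{\min}\le\mu_{\max}<\infty$ and $\inf_{x\sim y}w_{xy}>0$, with normalized Laplacian $\Delta$ and heat kernel $p(t,x,y)$. Let $u\in C_c(\mathbb Z^d)$, and let $$(\log(-\Delta)u)(x):=\frac{d}{ds}\Big|_{s=0}(-\Delta)^su(x)=\lim_{s\to0^+}\frac{(-\Delta)^su(x)-u(x)}{s},\qquad x\in\mathbb Z^d .$$ Then for each $x\in\mathbb Z^d$ this limit exists and $$(\log(-\Delta)u)(x)=\frac1{\mu(x)}\sum_{y\ne x}W_{\log}(x,y)\bigl(u(x)-u(y)\bigr)-\frac1{\mu(x)}\sum_{y\in\mathbb Z^d}W(x,y)\,u(y)+\Gamma'(1)\,u(x),$$ where the kernels $$W_{\log}(x,y):=\mu(x)\mu(y)\int_0^1p(t,x,y)\,t^{-1}dt,\qquad W(x,y):=\mu(x)\mu(y)\int_1^\infty p(t,x,y)\,t^{-1}dt$$ are symmetric and positive ($W_{\log}(x,y)$ being considered for $x\neq y$).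
   Context: Weighted lattice graph: vertex set $\mathbb Z^d$, with $x\sim y$ iff $|x-y|_1=1$; symmetric weights $w_{xy}=w_{yx}>0$ if $x\sim y$ and $w_{xy}=0$ otherwise (in particular $w_{xx}=0$); $\mu(x)=\sum_{y\sim x}w_{xy}$; $\mu_{\min}=\inf_x\mu(x)$, $\mu_{\max}=\sup_x\mu(x)$. $C_c(\mathbb Z^d)$ is the space of finitely supported real functions. The normalized Laplacian is $\Delta u(x)=\frac1{\mu(x)}\sum_{y\sim x}w_{xy}(u(y)-u(x))$, a bounded self-adjoint operator on $\ell^2(\mathbb Z^d,\mu)$. The heat kernel $p(t,x,y)$, $t\ge0$, is defined by $e^{t\Delta}u(x)=\sum_{y}p(t,x,y)u(y)\mu(y)$, i.e. $p(t,x,y)=\mu(y)^{-1}(e^{t\Delta}\mathbf 1_{\{y\}})(x)$. For $0<s<1$ the fractional Laplacian is $$(-\Delta)^su(x)=\frac1{\mu(x)}\sum_{y\ne x}W_s(x,y)\bigl(u(x)-u(y)\bigr),\qquad W_s(x,y)=\frac{s}{\Gamma(1-s)}\mu(x)\mu(y)\int_0^\infty p(t,x,y)\,t^{-1-s}\,dt ,$$ and $(-\Delta)^0u=u$. $\Gamma$ is Euler's Gamma function. *)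

theory Defs
  imports "HOL-Analysis.Analysis"
begin

text \<open>
  The lattice is \<^typ>\<open>int ^ 'd\<close> for a finite index type \<^typ>\<open>'d\<close>; types being nonempty,
  the dimension is an arbitrary positive integer.
\<close>

definition lattice_adj :: "int ^ 'd::finite \<Rightarrow> int ^ 'd \<Rightarrow> bool" where
  "lattice_adj x y \<longleftrightarrow> (\<Sum>i\<in>UNIV. \<bar>x $ i - y $ i\<bar>) = 1"

definition lattice_weight :: "(int ^ 'd::finite \<Rightarrow> int ^ 'd \<Rightarrow> real) \<Rightarrow> bool" where
  "lattice_weight w \<longleftrightarrow>
     (\<forall>x y. w x y = w y x) \<and>
     (\<forall>x y. lattice_adj x y \<longrightarrow> w x y > 0) \<and>
     (\<forall>x y. \<not> lattice_adj x y \<longrightarrow> w x y = 0)"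

definition vmeas :: "(int ^ 'd::finite \<Rightarrow> int ^ 'd \<Rightarrow> real) \<Rightarrow> int ^ 'd \<Rightarrow> real" where
  "vmeas w x = (\<Sum>y | lattice_adj x y. w x y)"

text \<open>The infima and suprema are taken in the extended reals, so that unbounded families get
  their true value.\<close>

definition vmeas_min :: "(int ^ 'd::finite \<Rightarrow> int ^ 'd \<Rightarrow> real) \<Rightarrow> ereal" where
  "vmeas_min w = (INF x. ereal (vmeas w x))"

definition vmeas_max :: "(int ^ 'd::finite \<Rightarrow> int ^ 'd \<Rightarrow> real) \<Rightarrow> ereal" where
  "vmeas_max w = (SUP x. ereal (vmeas w x))"

definition weight_inf :: "(int ^ 'd::finite \<Rightarrow> int ^ 'd \<Rightarrow> real) \<Rightarrow> ereal" where
  "weight_inf w = (INF (x, y)\<in>{(x, y). lattice_adj x y}. ereal (w x y))"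

definition laplacian ::
    "(int ^ 'd::finite \<Rightarrow> int ^ 'd \<Rightarrow> real) \<Rightarrow> (int ^ 'd \<Rightarrow> real) \<Rightarrow> int ^ 'd \<Rightarrow> real" where
  "laplacian w u x = (1 / vmeas w x) * (\<Sum>y | lattice_adj x y. w x y * (u y - u x))"

definition ell2 :: "(int ^ 'd::finite \<Rightarrow> real) \<Rightarrow> (int ^ 'd \<Rightarrow> real) set" where
  "ell2 m = {u. (\<lambda>x. (u x)\<^sup>2 * m x) summable_on UNIV}"

definition ell2_norm :: "(int ^ 'd::finite \<Rightarrow> real) \<Rightarrow> (int ^ 'd \<Rightarrow> real) \<Rightarrow> real" where
  "ell2_norm m u = sqrt (\<Sum>\<^sub>\<infinity>x. (u x)\<^sup>2 * m x)"

text \<open>The exponential of the bounded operator \<open>t\<Delta>\<close> on the weighted \<open>\<ell>\<^sup>2\<close> space, applied to \<open>u\<close>: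
  the \<open>\<ell>\<^sup>2\<close>-limit of the partial sums of \<open>\<Sum>n. (t\<^sup>n / n!) \<Delta>\<^sup>n u\<close>.\<close>

definition heat_semigroup ::
    "(int ^ 'd::finite \<Rightarrow> int ^ 'd \<Rightarrow> real) \<Rightarrow> real \<Rightarrow> (int ^ 'd \<Rightarrow> real) \<Rightarrow> int ^ 'd \<Rightarrow> real" where
  "heat_semigroup w t u =
     (THE v. v \<in> ell2 (vmeas w) \<and>
        (\<lambda>N. ell2_norm (vmeas w)
           (\<lambda>x. (\<Sum>n<N. t ^ n / fact n * (laplacian w ^^ n) u x) - v x)) \<longlonglongrightarrow> 0)"

definition heat_kernel ::
    "(int ^ 'd::finite \<Rightarrow> int ^ 'd \<Rightarrow> real) \<Rightarrow> real \<Rightarrow> int ^ 'd \<Rightarrow> int ^ 'd \<Rightarrow> real" where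
  "heat_kernel w t x y = heat_semigroup w t (indicator {y}) x / vmeas w y"

text \<open>The integrand defining \<open>frac_kernel\<close> and \<open>log_kernel\<close> is not integrable at \<open>0\<close> on the
  diagonal; these kernels are used only for \<open>x \<noteq> y\<close>.\<close>

definition frac_kernel ::
    "(int ^ 'd::finite \<Rightarrow> int ^ 'd \<Rightarrow> real) \<Rightarrow> real \<Rightarrow> int ^ 'd \<Rightarrow> int ^ 'd \<Rightarrow> real" where
  "frac_kernel w s x y =
     s / Gamma (1 - s) * vmeas w x * vmeas w y *
     (LINT t:{0<..}|lborel. heat_kernel w t x y * t powr (-1 - s))"

definition frac_laplacian ::
    "(int ^ 'd::finite \<Rightarrow> int ^ 'd \<Rightarrow> real) \<Rightarrow> real \<Rightarrow> (int ^ 'd \<Rightarrow> real) \<Rightarrow> int ^ 'd \<Rightarrow> real" where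
  "frac_laplacian w s u x =
     (if s = 0 then u x
      else (1 / vmeas w x) * (\<Sum>\<^sub>\<infinity>y\<in>UNIV - {x}. frac_kernel w s x y * (u x - u y)))"

definition log_laplacian ::
    "(int ^ 'd::finite \<Rightarrow> int ^ 'd \<Rightarrow> real) \<Rightarrow> (int ^ 'd \<Rightarrow> real) \<Rightarrow> int ^ 'd \<Rightarrow> real" where
  "log_laplacian w u x = Lim (at_right 0) (\<lambda>s. (frac_laplacian w s u x - u x) / s)"

definition log_kernel ::
    "(int ^ 'd::finite \<Rightarrow> int ^ 'd \<Rightarrow> real) \<Rightarrow> int ^ 'd \<Rightarrow> int ^ 'd \<Rightarrow> real" where
  "log_kernel w x y =
     vmeas w x * vmeas w y * (LINT t:{0<..<1}|lborel. heat_kernel w t x y / t)"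

definition tail_kernel ::
    "(int ^ 'd::finite \<Rightarrow> int ^ 'd \<Rightarrow> real) \<Rightarrow> int ^ 'd \<Rightarrow> int ^ 'd \<Rightarrow> real" where
  "tail_kernel w x y =
     vmeas w x * vmeas w y * (LINT t:{1<..}|lborel. heat_kernel w t x y / t)"

end

theory Submission imports Defs begin

text \<open>
  The heat flow is replaced by a random walk in discrete time. Let \<open>P = 1 + \<Delta>\<close> be the operator that
  averages over the neighbours with weights \<open>w x y / \<mu> x\<close>. Then \<open>e\<^sup>t\<^sup>\<Delta> = \<Sum>n. e\<^sup>-\<^sup>t t\<^sup>n / n! P\<^sup>n\<close>, so that
  \<open>\<mu> y p(t, x, y)\<close> is the mixture, with Poisson weights, of the probabilities \<open>P\<^sup>n(x, y)\<close> that the walk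
  from \<open>x\<close> is at \<open>y\<close> after \<open>n\<close> steps. Symmetry and positivity of the heat kernel are reversibility and
  irreducibility of the walk. Integrating the Poisson weights against \<open>t\<^sup>-\<^sup>1\<^sup>-\<^sup>s\<close> or \<open>t\<^sup>-\<^sup>1\<close> turns each of the
  kernels into a series in \<open>P\<^sup>n(x, y)\<close> with scalar coefficients, which leaves identities between
  coefficient sequences.

  For \<open>W\<^sub>s\<close> the coefficients are \<open>a\<^sub>n(s) = s (1 - s) \<dots> (n - 1 - s) / n!\<close>, those of \<open>1 - (1 - z)\<^sup>s\<close>. They
  sum to \<open>1\<close>, hence \<open>(-\<Delta>)\<^sup>s u = u - (\<Sum>n\<ge>1. a\<^sub>n(s) P\<^sup>n u)\<close>. Since \<open>0 \<le> a\<^sub>n(s) / s \<le> 1/n\<close> and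
  \<open>a\<^sub>n(s) / s \<rightarrow> 1/n\<close> as \<open>s \<rightarrow> 0\<close>, dominated convergence gives \<open>log(-\<Delta>) u = - (\<Sum>n\<ge>1. P\<^sup>n u / n)\<close>,
  as soon as \<open>\<Sum>n\<ge>1. \<bar>P\<^sup>n u x\<bar> / n\<close> converges.

  For that convergence any power decay of \<open>P\<^sup>n(x, y)\<close> suffices. Moving along a line in steps of length
  two bounds \<open>f x ^ 4\<close> by
  \<open>(\<parallel>f\<parallel>\<^sup>2 - \<parallel>P f\<parallel>\<^sup>2) \<parallel>f\<parallel>\<^sup>2\<close> up to a constant (lemma \<open>quartic_pointwise_bound\<close>). For \<open>f = P\<^sup>n g\<close> the
  first factor decreases in \<open>n\<close> and its sum over \<open>n\<close> telescopes, so it is \<open>O(1/n)\<close> and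
  \<open>P\<^sup>n(x, y) = O(n\<^sup>-\<^sup>1\<^sup>/\<^sup>4)\<close> (lemma \<open>walk_prob_decay\<close>).

  The coefficients of \<open>W_log\<close> and \<open>W\<close> are the integrals of \<open>e\<^sup>-\<^sup>t t\<^sup>n\<^sup>-\<^sup>1 / n!\<close> over \<open>(0, 1)\<close> and \<open>(1, \<infinity>)\<close>. They
  add up to \<open>1/n\<close> for \<open>n \<ge> 1\<close>, which reproduces \<open>- (\<Sum>n\<ge>1. P\<^sup>n u / n)\<close>. What is left over is a multiple
  of \<open>u x\<close>, namely the sum of the first coefficients over \<open>n \<ge> 1\<close> minus the second one at \<open>n = 0\<close>; this
  is \<open>- \<Gamma>'(1)\<close> (lemma \<open>deriv_Gamma_1\<close>), so the term \<open>\<Gamma>'(1) u x\<close> cancels it.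
\<close>

section \<open>Poisson weights and the Gamma function\<close>

definition poisson :: "nat \<Rightarrow> real \<Rightarrow> real" where
  "poisson n t = exp (- t) * t ^ n / fact n"

definition short_coeff :: "nat \<Rightarrow> real" where
  "short_coeff n = (LINT t:{0<..<1}|lborel. poisson n t / t)"

definition long_coeff :: "nat \<Rightarrow> real" where
  "long_coeff n = (LINT t:{1<..}|lborel. poisson n t / t)"

lemma poisson_nonneg: "0 \<le> t \<Longrightarrow> 0 \<le> poisson n t"
  by (simp add: poisson_def)

lemma has_bochner_integral_Gamma:
  fixes z :: real
  assumes "0 < z"
  shows "has_bochner_integral lborel (\<lambda>t. indicator {0<..} t *\<^sub>R (t powr (z - 1) * exp (- t))) (Gamma z)"
proof (rule has_bochner_integral_nn_integral)
  show "(\<integral>\<^sup>+ t. ennreal (indicator {0<..} t *\<^sub>R (t powr (z - 1) * exp (- t))) \<partial>lborel) = ennreal (Gamma z)"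
    unfolding Gamma_conv_nn_integral_real[OF assms]
    by (intro nn_integral_cong) (auto simp: indicator_def exp_minus divide_inverse)
qed (use assms in \<open>auto simp: Gamma_real_pos less_imp_le\<close>)

lemma has_bochner_integral_powr_01:
  fixes s :: real
  assumes "0 < s"
  shows "has_bochner_integral lborel (\<lambda>t. indicator {0<..<1} t *\<^sub>R t powr (s - 1)) (1 / s)"
proof (rule has_bochner_integral_nn_integral)
  have "(\<integral>\<^sup>+ t. ennreal (indicator {0<..<1} t *\<^sub>R t powr (s - 1)) \<partial>lborel)
      = (\<integral>\<^sup>+ t. ennreal (indicator {0..1} t * t powr (s - 1)) \<partial>lborel)"
    using AE_lborel_singleton[of 1]
    by (intro nn_integral_cong_AE) (auto elim!: eventually_mono simp: indicator_def)
  also have "\<dots> = ennreal (1 powr (s - 1 + 1) / (s - 1 + 1))"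
    by (rule nn_integral_has_integral_lebesgue[OF _ has_integral_powr_from_0]) (use assms in auto)
  finally show "(\<integral>\<^sup>+ t. ennreal (indicator {0<..<1} t *\<^sub>R t powr (s - 1)) \<partial>lborel) = ennreal (1 / s)"
    by simp
qed (use assms in auto)

lemma poisson_powr_integral:
  assumes "s < real n"
  shows "set_integrable lborel {0<..} (\<lambda>t. poisson n t * t powr (-1 - s))"
    "(LINT t:{0<..}|lborel. poisson n t * t powr (-1 - s)) = Gamma (real n - s) / fact n"
proof -
  have eq: "indicator {0<..} t *\<^sub>R (poisson n t * t powr (-1 - s))
      = (indicator {0<..} t *\<^sub>R (t powr (real n - s - 1) * exp (- t))) / fact n" for t :: real
  proof (cases "0 < t")
    case True
    have "t powr (real n - s - 1) = t powr real n * t powr (-1 - s)"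
      by (simp add: powr_add[symmetric] algebra_simps)
    thus ?thesis using True by (simp add: poisson_def powr_realpow)
  qed simp
  have "has_bochner_integral lborel (\<lambda>t. indicator {0<..} t *\<^sub>R (poisson n t * t powr (-1 - s))) (Gamma (real n - s) / fact n)"
    unfolding eq using assms by (intro has_bochner_integral_divide_zero has_bochner_integral_Gamma) simp
  thus "set_integrable lborel {0<..} (\<lambda>t. poisson n t * t powr (-1 - s))"
    "(LINT t:{0<..}|lborel. poisson n t * t powr (-1 - s)) = Gamma (real n - s) / fact n"
    by (simp_all add: set_integrable_def set_lebesgue_integral_def has_bochner_integral_iff)
qed

lemma poisson_div_integral:
  assumes "0 < n"
  shows "set_integrable lborel {0<..} (\<lambda>t. poisson n t / t)"
    "(LINT t:{0<..}|lborel. poisson n t / t) = 1 / real n"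
proof -
  have eq: "indicator {0<..} t *\<^sub>R (poisson n t * t powr (-1 - 0)) = indicator {0<..} t *\<^sub>R (poisson n t / t)" for t :: real
    by (auto simp: indicator_def powr_minus divide_inverse)
  have "(fact n :: real) = real n * Gamma (real n)"
  proof (cases n)
    case (Suc m)
    thus ?thesis using Gamma_fact[of m, where 'a = real] by (simp add: add.commute)
  qed (use assms in simp)
  moreover have "Gamma (real n) \<noteq> 0" using assms by (metis Gamma_real_pos less_irrefl of_nat_0_less_iff)
  ultimately show "set_integrable lborel {0<..} (\<lambda>t. poisson n t / t)"
    "(LINT t:{0<..}|lborel. poisson n t / t) = 1 / real n"
    unfolding set_integrable_def set_lebesgue_integral_def
    using poisson_powr_integral[of 0 n, unfolded set_integrable_def set_lebesgue_integral_def eq] assms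
    by simp_all
qed

lemma set_integrable_short: "0 < n \<Longrightarrow> set_integrable lborel {0<..<1} (\<lambda>t. poisson n t / t)"
  by (rule set_integrable_subset[OF poisson_div_integral(1)]) auto

lemma set_integrable_exp_tail: "set_integrable lborel {1<..} (\<lambda>t::real. exp (- t))"
proof -
  have "indicator {0<..} t *\<^sub>R (t powr (1 - 1) * exp (- t)) = indicator {0<..} t *\<^sub>R exp (- t)" for t :: real
    by (simp add: indicator_def)
  hence "set_integrable lborel {0<..} (\<lambda>t::real. exp (- t))"
    using has_bochner_integral_Gamma[of 1] by (simp only: set_integrable_def has_bochner_integral_iff)
  thus ?thesis by (rule set_integrable_subset) auto
qed

lemma set_integrable_long: "set_integrable lborel {1<..} (\<lambda>t. poisson n t / t)"
proof (cases "n = 0")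
  case True
  show ?thesis
    by (rule set_integrable_bound[OF set_integrable_exp_tail])
      (auto simp: True poisson_def set_borel_measurable_def divide_simps)
next
  case False
  thus ?thesis by (intro set_integrable_subset[OF poisson_div_integral(1)]) auto
qed

lemma short_coeff_nonneg: "0 \<le> short_coeff n"
  unfolding short_coeff_def set_lebesgue_integral_def
  by (intro integral_nonneg_AE always_eventually) (simp add: indicator_def poisson_nonneg)

lemma long_coeff_nonneg: "0 \<le> long_coeff n"
  unfolding long_coeff_def set_lebesgue_integral_def
  by (intro integral_nonneg_AE always_eventually) (simp add: indicator_def poisson_nonneg)

lemma set_integral_split_at_1:
  fixes f :: "real \<Rightarrow> real"
  assumes "set_integrable lborel {0<..} f"
  shows "(LINT t:{0<..}|lborel. f t) = (LINT t:{0<..<1}|lborel. f t) + (LINT t:{1<..}|lborel. f t)"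
proof -
  have "(LINT t:{0<..}|lborel. f t) = (LINT t:{0<..<1} \<union> {1<..}|lborel. f t)"
    by (rule set_integral_discrete_difference[of "{1}"]) auto
  also have "\<dots> = (LINT t:{0<..<1}|lborel. f t) + (LINT t:{1<..}|lborel. f t)"
    by (rule set_integral_Un) (auto intro: set_integrable_subset[OF assms])
  finally show ?thesis .
qed

lemma short_plus_long_coeff: "0 < n \<Longrightarrow> short_coeff n + long_coeff n = 1 / real n"
  using set_integral_split_at_1[OF poisson_div_integral(1)] poisson_div_integral(2)
  by (simp add: short_coeff_def long_coeff_def)

text \<open>The weights \<open>poisson n t\<close> with \<open>n \<ge> 1\<close> sum to \<open>1 - exp (- t)\<close>.\<close>

lemma short_coeff_sums:
  "(\<lambda>n. short_coeff (Suc n)) sums (LINT t:{0<..<1}|lborel. (1 - exp (- t)) / t)"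
proof -
  define f where "f n t = indicator {0<..<1} t *\<^sub>R (poisson (Suc n) t / t)" for n and t :: real
  have f_int: "integrable lborel (f n)" for n
    using set_integrable_short[of "Suc n"] by (simp add: f_def[abs_def] set_integrable_def)
  have f_nonneg: "0 \<le> f n t" for n t by (simp add: f_def indicator_def poisson_nonneg)
  have f_sums: "(\<lambda>n. f n t) sums (indicator {0<..<1} t *\<^sub>R ((1 - exp (- t)) / t))" for t
  proof (cases "t \<in> {0<..<1}")
    case True
    have "(\<lambda>n. t ^ n / fact n) sums exp t"
      using exp_converges[of t] by (simp add: divide_inverse mult.commute)
    hence "(\<lambda>n. t ^ Suc n / fact (Suc n)) sums (exp t - 1)"
      by (subst sums_Suc_iff) simp
    hence "(\<lambda>n. exp (- t) * (t ^ Suc n / fact (Suc n)) / t) sums (exp (- t) * (exp t - 1) / t)"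
      by (intro sums_divide sums_mult)
    moreover have "exp (- t) * (exp t - 1) = 1 - exp (- t)"
      by (simp add: right_diff_distrib exp_minus)
    ultimately show ?thesis using True by (simp add: f_def poisson_def)
  qed (simp add: f_def)
  have "(\<lambda>n. integral\<^sup>L lborel (f n)) sums (\<integral>t. (\<Sum>n. f n t) \<partial>lborel)"
  proof (rule sums_integral[OF f_int])
    show "AE t in lborel. summable (\<lambda>n. norm (f n t))"
      using sums_summable[OF f_sums] f_nonneg by (intro always_eventually allI) simp
    show "summable (\<lambda>n. \<integral>t. norm (f n t) \<partial>lborel)"
    proof (rule summable_comparison_test')
      show "summable (\<lambda>n. 1 / fact (Suc n) :: real)"
        using summable_exp[of "1::real"] by (subst summable_Suc_iff) (simp add: divide_inverse)
      show "norm (\<integral>t. norm (f n t) \<partial>lborel) \<le> 1 / fact (Suc n)" if "0 \<le> n" for n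
      proof -
        have "(\<integral>t. f n t \<partial>lborel) \<le> (\<integral>t. indicator {0<..<1::real} t / fact (Suc n) \<partial>lborel)"
        proof (rule Bochner_Integration.integral_mono[OF f_int])
          fix t :: real
          show "f n t \<le> indicator {0<..<1} t / fact (Suc n)"
          proof (cases "t \<in> {0<..<1}")
            case True
            have "exp (- t) * t ^ n \<le> 1 * 1"
              using True by (intro mult_mono power_le_one) auto
            thus ?thesis using True by (simp add: f_def poisson_def divide_simps)
          qed (simp add: f_def)
        qed auto
        also have "\<dots> = 1 / fact (Suc n)" by simp
        finally show ?thesis using f_nonneg by (simp add: integral_nonneg_AE)
      qed
    qed
  qed
  moreover have "(\<Sum>n. f n t) = indicator {0<..<1} t *\<^sub>R ((1 - exp (- t)) / t)" for t
    using f_sums[of t] by (rule sums_unique[symmetric])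
  moreover have "integral\<^sup>L lborel (f n) = short_coeff (Suc n)" for n
    by (simp only: f_def[abs_def] short_coeff_def set_lebesgue_integral_def)
  ultimately show ?thesis by (simp only: set_lebesgue_integral_def)
qed

text \<open>For \<open>s > 0\<close> write \<open>\<Gamma>(1 + s) = s \<Gamma>(s)\<close>, split Euler's integral for \<open>\<Gamma>(s)\<close> at \<open>1\<close>, and subtract
  \<open>1 / s\<close>, the integral of \<open>t powr (s - 1)\<close> over \<open>(0, 1)\<close>. The difference quotient of \<open>\<Gamma>\<close> at \<open>1\<close> becomes the
  integral of \<open>exp (- t) * t powr (s - 1)\<close> over \<open>(1, \<infinity>)\<close> minus that of
  \<open>(1 - exp (- t)) * t powr (s - 1)\<close> over \<open>(0, 1)\<close>. Both have integrable majorants for \<open>s \<le> 1\<close>, so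
  \<open>s \<rightarrow> 0\<close> is allowed under the integral.\<close>

lemma deriv_Gamma_1: "deriv Gamma (1::real) = long_coeff 0 - (\<Sum>n. short_coeff (Suc n))"
proof -
  define s where "s k = inverse (real (Suc k))" for k
  have s: "0 < s k" "s k \<le> 1" for k by (auto simp: s_def divide_simps)
  have s_lim: "s \<longlonglongrightarrow> 0" unfolding s_def[abs_def] by (rule LIMSEQ_inverse_real_of_nat)
  define A where "A k t = indicator {0<..<1} t *\<^sub>R ((1 - exp (- t)) * t powr (s k - 1))" for k and t :: real
  define B where "B k t = indicator {1<..} t *\<^sub>R (exp (- t) * t powr (s k - 1))" for k and t :: real
  have quot: "(Gamma (1 + s k) - Gamma 1) / s k = integral\<^sup>L lborel (B k) - integral\<^sup>L lborel (A k)" for k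
  proof -
    let ?g = "\<lambda>t. t powr (s k - 1) * exp (- t)"
    note G = has_bochner_integral_Gamma[OF s(1)[of k]]
    note P = has_bochner_integral_powr_01[OF s(1)[of k]]
    have int: "set_integrable lborel {0<..} ?g"
      using G by (simp add: set_integrable_def has_bochner_integral_iff)
    have int01: "set_integrable lborel {0<..<1} ?g" by (rule set_integrable_subset[OF int]) auto
    have "Gamma (s k) = (LINT t:{0<..}|lborel. ?g t)"
      using G by (simp add: set_lebesgue_integral_def has_bochner_integral_iff)
    also have "\<dots> = (LINT t:{0<..<1}|lborel. ?g t) + (LINT t:{1<..}|lborel. ?g t)"
      by (rule set_integral_split_at_1[OF int])
    also have "(LINT t:{1<..}|lborel. ?g t) = integral\<^sup>L lborel (B k)"
      unfolding set_lebesgue_integral_def by (intro Bochner_Integration.integral_cong) (simp_all add: B_def)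
    finally have 1: "Gamma (s k) = (LINT t:{0<..<1}|lborel. ?g t) + integral\<^sup>L lborel (B k)" .
    have "integral\<^sup>L lborel (A k)
        = (\<integral>t. indicator {0<..<1} t *\<^sub>R t powr (s k - 1) - indicator {0<..<1} t *\<^sub>R ?g t \<partial>lborel)"
      by (intro Bochner_Integration.integral_cong) (auto simp: A_def algebra_simps)
    also have "\<dots> = 1 / s k - (LINT t:{0<..<1}|lborel. ?g t)"
      using P int01 by (subst Bochner_Integration.integral_diff)
        (auto simp: has_bochner_integral_iff set_integrable_def set_lebesgue_integral_def)
    finally have 2: "integral\<^sup>L lborel (A k) = 1 / s k - (LINT t:{0<..<1}|lborel. ?g t)" .
    have "s k \<notin> \<int>\<^sub>\<le>\<^sub>0" using s(1)[of k] by (auto elim!: nonpos_Ints_cases)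
    hence "Gamma (1 + s k) = s k * Gamma (s k)"
      using Gamma_plus1[of "s k"] by (simp add: add.commute)
    thus ?thesis using s(1)[of k] by (simp add: 1 2 field_simps)
  qed
  have powr_lim: "(\<lambda>k. t powr (s k - 1)) \<longlonglongrightarrow> inverse t" if "0 < t" for t
  proof -
    have "(\<lambda>k. t powr (s k - 1)) \<longlonglongrightarrow> t powr (0 - 1)"
      using that by (intro tendsto_powr tendsto_diff tendsto_const s_lim) auto
    thus ?thesis using that by (simp add: powr_minus)
  qed
  have A_lim: "(\<lambda>k. integral\<^sup>L lborel (A k)) \<longlonglongrightarrow> (\<integral>t. indicator {0<..<1} t *\<^sub>R ((1 - exp (- t)) / t) \<partial>lborel)"
  proof (rule integral_dominated_convergence[where w = "indicator {0<..<1}"])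
    show "AE t in lborel. (\<lambda>k. A k t) \<longlonglongrightarrow> indicator {0<..<1} t *\<^sub>R ((1 - exp (- t)) / t)"
    proof (intro always_eventually allI)
      fix t :: real
      show "(\<lambda>k. A k t) \<longlonglongrightarrow> indicator {0<..<1} t *\<^sub>R ((1 - exp (- t)) / t)"
        unfolding A_def divide_inverse
        by (cases "t \<in> {0<..<1}") (auto intro!: tendsto_mult powr_lim)
    qed
    show "AE t in lborel. norm (A k t) \<le> indicator {0<..<1} t" for k
    proof (intro always_eventually allI)
      fix t :: real
      show "norm (A k t) \<le> indicator {0<..<1} t"
      proof (cases "t \<in> {0<..<1}")
        case True
        have "t powr (s k - 1) \<le> t powr (- 1)"
          using True s(1)[of k] by (intro powr_mono') auto
        moreover have "1 - exp (- t) \<le> t" "0 \<le> 1 - exp (- t)" using exp_ge_add_one_self[of "- t"] True by auto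
        ultimately have "(1 - exp (- t)) * t powr (s k - 1) \<le> t * t powr (- 1)"
          using True by (intro mult_mono) auto
        thus ?thesis using True by (simp add: A_def powr_minus abs_mult)
      qed (simp add: A_def)
    qed
  qed (auto simp: A_def[abs_def])
  have B_lim: "(\<lambda>k. integral\<^sup>L lborel (B k)) \<longlonglongrightarrow> (\<integral>t. indicator {1<..} t *\<^sub>R (exp (- t) / t) \<partial>lborel)"
  proof (rule integral_dominated_convergence[where w = "\<lambda>t. indicator {1<..} t *\<^sub>R exp (- t)"])
    show "AE t in lborel. (\<lambda>k. B k t) \<longlonglongrightarrow> indicator {1<..} t *\<^sub>R (exp (- t) / t)"
    proof (intro always_eventually allI)
      fix t :: real
      show "(\<lambda>k. B k t) \<longlonglongrightarrow> indicator {1<..} t *\<^sub>R (exp (- t) / t)"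
        unfolding B_def divide_inverse
        by (cases "t \<in> {1<..}") (auto intro!: tendsto_mult powr_lim)
    qed
    show "AE t in lborel. norm (B k t) \<le> indicator {1<..} t *\<^sub>R exp (- t)" for k
    proof (intro always_eventually allI)
      fix t :: real
      show "norm (B k t) \<le> indicator {1<..} t *\<^sub>R exp (- t)"
      proof (cases "t \<in> {1<..}")
        case True
        have "t powr (s k - 1) \<le> t powr 0" using True s(2)[of k] by (intro powr_mono) auto
        thus ?thesis using True by (simp add: B_def)
      qed (simp add: B_def)
    qed
    show "integrable lborel (\<lambda>t. indicator {1<..} t *\<^sub>R exp (- t) :: real)"
      using set_integrable_exp_tail by (simp add: set_integrable_def)
  qed (auto simp: B_def[abs_def])
  have "(Gamma has_field_derivative deriv Gamma 1) (at (1::real))"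
    using has_field_derivative_Gamma[of "1::real"] DERIV_imp_deriv by force
  hence "((\<lambda>h. (Gamma (1 + h) - Gamma 1) / h) \<longlongrightarrow> deriv Gamma (1::real)) (at 0)"
    by (simp add: DERIV_def)
  moreover have "filterlim s (at 0) sequentially"
  proof -
    have "s k \<noteq> 0" for k using s(1)[of k] by simp
    thus ?thesis using s_lim by (simp add: filterlim_at)
  qed
  ultimately have "(\<lambda>k. (Gamma (1 + s k) - Gamma 1) / s k) \<longlonglongrightarrow> deriv Gamma 1"
    by (rule filterlim_compose)
  moreover have "(\<lambda>k. (Gamma (1 + s k) - Gamma 1) / s k) \<longlonglongrightarrow>
      (\<integral>t. indicator {1<..} t *\<^sub>R (exp (- t) / t) \<partial>lborel) - (\<integral>t. indicator {0<..<1} t *\<^sub>R ((1 - exp (- t)) / t) \<partial>lborel)"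
    unfolding quot by (intro tendsto_diff A_lim B_lim)
  ultimately have "deriv Gamma 1 = (\<integral>t. indicator {1<..} t *\<^sub>R (exp (- t) / t) \<partial>lborel)
      - (\<integral>t. indicator {0<..<1} t *\<^sub>R ((1 - exp (- t)) / t) \<partial>(lborel :: real measure))"
    by (rule LIMSEQ_unique)
  thus ?thesis using short_coeff_sums
    by (simp add: sums_iff long_coeff_def poisson_def set_lebesgue_integral_def)
qed

section \<open>The binomial coefficients of the fractional power\<close>

text \<open>The coefficient of \<open>z ^ Suc n\<close> in the binomial series of \<open>1 - (1 - z) powr s\<close>. The index is
  shifted because the constant term vanishes.\<close>

definition frac_coeff :: "real \<Rightarrow> nat \<Rightarrow> real" where
  "frac_coeff s n = s * pochhammer (1 - s) n / fact (Suc n)"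

lemma frac_coeff_eq_Gamma:
  assumes "s < 1"
  shows "frac_coeff s n = s / Gamma (1 - s) * (Gamma (real (Suc n) - s) / fact (Suc n))"
proof -
  have "pochhammer (1 - s) n = Gamma (1 - s + real n) / Gamma (1 - s)"
    using assms by (intro pochhammer_Gamma) (auto elim!: nonpos_Ints_cases)
  thus ?thesis by (simp add: frac_coeff_def algebra_simps)
qed

lemma frac_coeff_eq_prod: "frac_coeff s n = s / real (Suc n) * (\<Prod>k<n. 1 - s / real (Suc k))"
proof -
  have "pochhammer (1 - s) n / fact n = (\<Prod>k<n. 1 - s / real (Suc k))"
  proof (induction n)
    case (Suc n)
    have "(1 - s + real n) / real (Suc n) = 1 - s / real (Suc n)" by (simp add: field_simps)
    moreover have "pochhammer (1 - s) (Suc n) / fact (Suc n)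
        = pochhammer (1 - s) n / fact n * ((1 - s + real n) / real (Suc n))"
      by (simp add: pochhammer_Suc mult.commute)
    ultimately show ?case using Suc by simp
  qed simp
  moreover have "frac_coeff s n = s / real (Suc n) * (pochhammer (1 - s) n / fact n)"
    by (simp add: frac_coeff_def mult.commute)
  ultimately show ?thesis by simp
qed

lemma frac_coeff_partial_sum: "(\<Sum>n<N. frac_coeff s n) = 1 - (\<Prod>k<N. 1 - s / real (Suc k))"
proof (induction N)
  case (Suc N)
  thus ?case by (simp add: frac_coeff_eq_prod algebra_simps)
qed simp

text \<open>The partial sums telescope to \<open>1 - (\<Prod>k<N. 1 - s / real (Suc k))\<close>, and the product tends to \<open>0\<close>
  because the harmonic series diverges.\<close>

lemma frac_coeff_sums:
  assumes "0 < s" "s < 1"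
  shows "frac_coeff s sums 1"
proof -
  have "(\<lambda>N. \<Prod>k<N. 1 - s / real (Suc k)) \<longlonglongrightarrow> 0"
  proof (rule tendsto_sandwich[OF _ _ tendsto_const])
    have le1: "s / real (Suc k) \<le> 1" for k using assms by (simp add: divide_simps)
    show "\<forall>\<^sub>F N in sequentially. 0 \<le> (\<Prod>k<N. 1 - s / real (Suc k))"
      using le1 by (intro always_eventually allI prod_nonneg) simp
    have "(\<Prod>k<N. 1 - s / real (Suc k)) \<le> (\<Prod>k<N. exp (- (s / real (Suc k))))" for N
    proof (intro prod_mono conjI)
      fix k show "1 - s / real (Suc k) \<le> exp (- (s / real (Suc k)))"
        using exp_ge_add_one_self[of "- (s / real (Suc k))"] by simp
      show "0 \<le> 1 - s / real (Suc k)" using le1[of k] by simp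
    qed
    also have "(\<Prod>k<N. exp (- (s / real (Suc k)))) = exp (- (s * harm N))" for N
      by (simp add: exp_sum[symmetric] sum_negf sum_distrib_left harm_def divide_inverse lessThan_atLeast0 sum.atLeast1_atMost_eq)
    finally show "\<forall>\<^sub>F N in sequentially. (\<Prod>k<N. 1 - s / real (Suc k)) \<le> exp (- (s * harm N))"
      by (intro always_eventually allI)
    have "filterlim (\<lambda>N. s * harm N) at_top sequentially"
      using assms(1) harm_at_top by (intro filterlim_tendsto_pos_mult_at_top[OF tendsto_const])
    hence "filterlim (\<lambda>N. - (s * harm N)) at_bot sequentially"
      by (simp add: filterlim_uminus_at_top)
    thus "(\<lambda>N. exp (- (s * harm N))) \<longlonglongrightarrow> 0" by (rule filterlim_compose[OF exp_at_bot])
  qed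
  hence "(\<lambda>N. 1 - (\<Prod>k<N. 1 - s / real (Suc k))) \<longlonglongrightarrow> 1 - 0"
    by (intro tendsto_diff tendsto_const)
  thus ?thesis by (simp add: sums_def frac_coeff_partial_sum)
qed

lemma frac_coeff_nonneg: "0 \<le> s \<Longrightarrow> s < 1 \<Longrightarrow> 0 \<le> frac_coeff s n"
  by (simp add: frac_coeff_def pochhammer_nonneg)

lemma frac_coeff_div_le:
  assumes "0 < s" "s < 1"
  shows "frac_coeff s n / s \<le> 1 / real (Suc n)"
proof -
  have "(\<Prod>k<n. 1 - s / real (Suc k)) \<le> (\<Prod>k<n. 1)"
    using assms by (intro prod_mono) (auto simp: divide_simps)
  hence "(\<Prod>k<n. 1 - s / real (Suc k)) / real (Suc n) \<le> 1 / real (Suc n)"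
    by (intro divide_right_mono) auto
  thus ?thesis using assms by (simp add: frac_coeff_eq_prod)
qed

lemma frac_coeff_div_tendsto: "((\<lambda>s. frac_coeff s n / s) \<longlongrightarrow> 1 / real (Suc n)) (at_right 0)"
proof (rule Lim_transform_eventually)
  have "((\<lambda>s. (\<Prod>k<n. 1 - s / real (Suc k)) / real (Suc n)) \<longlongrightarrow> (\<Prod>k<n. 1 - 0 / real (Suc k)) / real (Suc n)) (at_right 0)"
    by (intro tendsto_intros) auto
  thus "((\<lambda>s. (\<Prod>k<n. 1 - s / real (Suc k)) / real (Suc n)) \<longlongrightarrow> 1 / real (Suc n)) (at_right 0)" by simp
  show "\<forall>\<^sub>F s in at_right 0. (\<Prod>k<n. 1 - s / real (Suc k)) / real (Suc n) = frac_coeff s n / s"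
    by (auto simp: eventually_at_filter frac_coeff_eq_prod)
qed

section \<open>Weights bounded below\<close>

lemma has_sum_sum:
  fixes f :: "'i \<Rightarrow> 'a \<Rightarrow> 'b::topological_comm_monoid_add"
  assumes "finite I" "\<And>i. i \<in> I \<Longrightarrow> (f i has_sum s i) A"
  shows "((\<lambda>x. \<Sum>i\<in>I. f i x) has_sum (\<Sum>i\<in>I. s i)) A"
  using assms by (induction rule: finite_induct) (auto intro!: has_sum_add)

lemma set_integral_pos:
  fixes f :: "'a \<Rightarrow> real"
  assumes int: "set_integrable M A f" and A: "A \<in> sets M" "emeasure M A \<noteq> 0"
    and pos: "\<And>x. x \<in> A \<Longrightarrow> 0 < f x"
  shows "0 < (LINT x:A|M. f x)"
proof -
  let ?g = "\<lambda>x. indicator A x *\<^sub>R f x"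
  have g: "integrable M ?g" using int by (simp add: set_integrable_def)
  have nn: "AE x in M. 0 \<le> ?g x"
    using pos by (intro always_eventually) (simp add: indicator_def less_imp_le)
  have "integral\<^sup>L M ?g \<noteq> 0"
  proof
    assume "integral\<^sup>L M ?g = 0"
    hence "AE x in M. ?g x = 0" by (simp only: integral_nonneg_eq_0_iff_AE[OF g nn])
    hence "AE x in M. x \<notin> A" by (rule eventually_mono) (use pos in force)
    hence "A \<in> null_sets M" using A(1) AE_iff_null_sets by blast
    with A(2) show False by blast
  qed
  moreover have "0 \<le> integral\<^sup>L M ?g" using nn by (rule integral_nonneg_AE)
  ultimately show ?thesis by (simp add: set_lebesgue_integral_def)
qed

locale lattice_walk =
  fixes w :: "int ^ 'd::finite \<Rightarrow> int ^ 'd \<Rightarrow> real"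
  assumes weight: "lattice_weight w"
    and vmeas_min_pos: "0 < vmeas_min w"
    and weight_inf_pos: "0 < weight_inf w"
begin

definition nbrs :: "int ^ 'd \<Rightarrow> (int ^ 'd) set" where
  "nbrs x = {y. lattice_adj x y}"

lemma weight_sym: "w x y = w y x"
  using weight by (auto simp: lattice_weight_def)

lemma weight_nonneg: "0 \<le> w x y"
  using weight unfolding lattice_weight_def by (metis less_eq_real_def)

lemma weight_pos: "y \<in> nbrs x \<Longrightarrow> 0 < w x y"
  using weight by (auto simp: lattice_weight_def nbrs_def)

lemma weight_eq_0: "y \<notin> nbrs x \<Longrightarrow> w x y = 0"
  using weight by (auto simp: lattice_weight_def nbrs_def)

lemma vmeas_lower_bound: obtains m where "0 < m" "\<And>x. m \<le> vmeas w x"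
proof -
  obtain m where m: "0 < ereal m" "ereal m < vmeas_min w"
    using vmeas_min_pos ereal_dense2 by blast
  have "m \<le> vmeas w x" for x
  proof -
    have "vmeas_min w \<le> ereal (vmeas w x)" unfolding vmeas_min_def by (rule INF_lower) simp
    with m(2) have "ereal m < ereal (vmeas w x)" by (rule less_le_trans)
    thus ?thesis by simp
  qed
  with m show ?thesis using that by simp
qed

lemma vmeas_pos: "0 < vmeas w x"
  by (metis vmeas_lower_bound less_le_trans)

lemma weight_lower_bound: obtains c where "0 < c" "\<And>x y. y \<in> nbrs x \<Longrightarrow> c \<le> w x y"
proof -
  obtain c where c: "0 < ereal c" "ereal c < weight_inf w"
    using weight_inf_pos ereal_dense2 by blast
  have "c \<le> w x y" if "y \<in> nbrs x" for x y
  proof -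
    have "weight_inf w \<le> ereal (w x y)"
      unfolding weight_inf_def using that by (intro INF_lower2[of "(x, y)"]) (auto simp: nbrs_def)
    with c(2) have "ereal c < ereal (w x y)" by (rule less_le_trans)
    thus ?thesis by simp
  qed
  with c show ?thesis using that by simp
qed

text \<open>A sum over an infinite set is \<open>0\<close> by convention, whereas the vertex measure is positive;
  so every vertex has finitely many neighbours.\<close>

lemma finite_nbrs [simp]: "finite (nbrs x)"
proof (rule ccontr)
  assume "infinite (nbrs x)"
  hence "vmeas w x = 0" by (simp add: vmeas_def nbrs_def)
  with vmeas_pos[of x] show False by simp
qed

lemma nbrs_sym: "y \<in> nbrs x \<longleftrightarrow> x \<in> nbrs y"
  by (simp add: nbrs_def lattice_adj_def abs_minus_commute)

lemma vmeas_eq_sum: "vmeas w x = (\<Sum>y\<in>nbrs x. w x y)"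
  by (simp add: vmeas_def nbrs_def)

section \<open>The averaging operator and its random walk\<close>

definition avg :: "(int ^ 'd \<Rightarrow> real) \<Rightarrow> int ^ 'd \<Rightarrow> real" where
  "avg f x = (\<Sum>y\<in>nbrs x. w x y * f y) / vmeas w x"

definition walk_prob :: "nat \<Rightarrow> int ^ 'd \<Rightarrow> int ^ 'd \<Rightarrow> real" where
  "walk_prob n x y = (avg ^^ n) (indicator {y}) x"

definition finsupp :: "(int ^ 'd \<Rightarrow> real) \<Rightarrow> bool" where
  "finsupp f \<longleftrightarrow> finite {x. f x \<noteq> 0}"

text \<open>The inner product of \<open>\<ell>\<^sup>2(\<mu>)\<close>. It is only applied to pairs in which one function has finite
  support, where the sum is finite.\<close>

definition inner_vm :: "(int ^ 'd \<Rightarrow> real) \<Rightarrow> (int ^ 'd \<Rightarrow> real) \<Rightarrow> real" where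
  "inner_vm f g = (\<Sum>\<^sub>\<infinity>x. vmeas w x * (f x * g x))"

lemma laplacian_eq_avg: "laplacian w u x = avg u x - u x"
  using vmeas_pos[of x]
  by (simp add: laplacian_def avg_def nbrs_def[symmetric] right_diff_distrib sum_subtractf
      sum_distrib_right[symmetric] vmeas_eq_sum[symmetric] diff_divide_distrib)

lemma avg_eq_sum:
  assumes "finite B" "\<And>y. y \<notin> B \<Longrightarrow> f y = 0"
  shows "avg f x = (\<Sum>y\<in>B. w x y * f y) / vmeas w x"
proof -
  have "(\<Sum>y\<in>nbrs x. w x y * f y) = (\<Sum>y\<in>B. w x y * f y)"
    using assms weight_eq_0 by (intro sum.mono_neutral_cong) auto
  thus ?thesis by (simp add: avg_def)
qed

lemma avg_nonneg: "(\<And>x. 0 \<le> f x) \<Longrightarrow> 0 \<le> avg f x"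
  unfolding avg_def using vmeas_pos[of x] weight_nonneg
  by (intro divide_nonneg_pos sum_nonneg) auto

lemma avg_const: "(\<And>y. y \<in> nbrs x \<Longrightarrow> f y = c) \<Longrightarrow> avg f x = c"
  using vmeas_pos[of x]
  by (simp add: avg_def vmeas_eq_sum sum_distrib_right[symmetric])

lemma avg_mono: "(\<And>x. f x \<le> g x) \<Longrightarrow> avg f x \<le> avg g x"
  unfolding avg_def using vmeas_pos[of x] weight_nonneg
  by (intro divide_right_mono sum_mono mult_left_mono) auto

lemma avg_sum: "avg (\<lambda>z. \<Sum>i\<in>I. f i z) x = (\<Sum>i\<in>I. avg (f i) x)"
  unfolding avg_def by (simp add: sum_distrib_left sum_divide_distrib) (subst sum.swap, rule refl)

lemma avg_cmult: "avg (\<lambda>z. c * f z) x = c * avg f x"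
  unfolding avg_def by (simp add: sum_distrib_left mult.left_commute)

lemma finsupp_indicator [simp]: "finsupp (indicator {y})"
  by (simp add: finsupp_def indicator_def)

lemma finsupp_avg [simp]:
  assumes "finsupp f" shows "finsupp (avg f)"
proof -
  have "avg f x = 0" if "x \<notin> (\<Union>y\<in>{y. f y \<noteq> 0}. nbrs y)" for x
  proof -
    have "w x y * f y = 0" if "y \<in> nbrs x" for y
      using that \<open>x \<notin> _\<close> nbrs_sym[of x y] by auto
    hence "(\<Sum>y\<in>nbrs x. w x y * f y) = 0" by (rule sum.neutral[rule_format])
    thus ?thesis by (simp add: avg_def)
  qed
  hence "{x. avg f x \<noteq> 0} \<subseteq> (\<Union>y\<in>{y. f y \<noteq> 0}. nbrs y)" by blast
  thus ?thesis using assms unfolding finsupp_def by (auto elim!: finite_subset)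
qed

lemma finsupp_funpow_avg [simp]: "finsupp f \<Longrightarrow> finsupp ((avg ^^ n) f)"
  by (induction n) auto

lemma inner_vm_eq_sum:
  assumes "finite B" "\<And>x. x \<notin> B \<Longrightarrow> f x * g x = 0"
  shows "inner_vm f g = (\<Sum>x\<in>B. vmeas w x * (f x * g x))"
proof -
  have "inner_vm f g = (\<Sum>\<^sub>\<infinity>x\<in>B. vmeas w x * (f x * g x))"
    unfolding inner_vm_def using assms by (intro infsum_cong_neutral) auto
  thus ?thesis using assms by simp
qed

lemma inner_vm_commute: "inner_vm f g = inner_vm g f"
  by (simp add: inner_vm_def mult.commute)

lemma inner_vm_nonneg: "0 \<le> inner_vm f f"
  unfolding inner_vm_def using vmeas_pos by (intro infsum_nonneg) (simp add: less_imp_le)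

lemma inner_vm_indicator: "inner_vm f (indicator {y}) = vmeas w y * f y"
  by (subst inner_vm_eq_sum[of "{y}"]) auto

text \<open>Both sides are the sum of \<open>w x y * f y * g x\<close> over a finite square, and \<open>w\<close> is symmetric.\<close>

lemma inner_vm_avg:
  assumes "finsupp f" "finsupp g"
  shows "inner_vm (avg f) g = inner_vm f (avg g)"
proof -
  define B where "B = {x. f x \<noteq> 0} \<union> {x. g x \<noteq> 0}"
  have B: "finite B" "\<And>x. x \<notin> B \<Longrightarrow> f x = 0" "\<And>x. x \<notin> B \<Longrightarrow> g x = 0"
    using assms by (auto simp: B_def finsupp_def)
  have v: "vmeas w x \<noteq> 0" for x using vmeas_pos[of x] by simp
  have "inner_vm (avg f) g = (\<Sum>x\<in>B. \<Sum>y\<in>B. w x y * f y * g x)"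
    using B v by (simp add: inner_vm_eq_sum[of B] avg_eq_sum[of B f] sum_distrib_right)
  also have "\<dots> = (\<Sum>y\<in>B. \<Sum>x\<in>B. w y x * g x * f y)"
    by (subst sum.swap) (intro sum.cong refl, simp only: weight_sym mult_ac)
  also have "\<dots> = inner_vm f (avg g)"
    using B v by (simp add: inner_vm_eq_sum[of B] avg_eq_sum[of B g] sum_distrib_left[symmetric]
        sum_distrib_right[symmetric] mult.commute)
  finally show ?thesis .
qed

lemma inner_vm_funpow_avg:
  "finsupp f \<Longrightarrow> finsupp g \<Longrightarrow> inner_vm ((avg ^^ n) f) g = inner_vm f ((avg ^^ n) g)"
proof (induction n arbitrary: g)
  case (Suc n)
  have "inner_vm ((avg ^^ Suc n) f) g = inner_vm ((avg ^^ n) f) (avg g)"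
    using Suc.prems by (simp add: inner_vm_avg)
  also have "\<dots> = inner_vm f ((avg ^^ n) (avg g))" using Suc by simp
  finally show ?case by (simp add: funpow_swap1)
qed simp

lemma walk_prob_0: "walk_prob 0 x y = (if x = y then 1 else 0)"
  by (simp add: walk_prob_def indicator_def)

lemma walk_prob_Suc: "walk_prob (Suc n) x y = (\<Sum>z\<in>nbrs x. w x z * walk_prob n z y) / vmeas w x"
  by (simp add: walk_prob_def avg_def)

lemma walk_prob_nonneg: "0 \<le> walk_prob n x y"
  by (induction n arbitrary: x) (simp_all add: walk_prob_def avg_nonneg)

lemma walk_prob_le_1: "walk_prob n x y \<le> 1"
proof (induction n arbitrary: x)
  case (Suc n)
  have "walk_prob (Suc n) x y = avg (\<lambda>z. walk_prob n z y) x" by (simp add: walk_prob_def)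
  also have "\<dots> \<le> avg (\<lambda>z. 1) x" by (intro avg_mono Suc)
  finally show ?case by (simp add: avg_const)
qed (simp add: walk_prob_0)

text \<open>Self-adjointness of the averaging operator, tested on two indicators, is reversibility of
  the random walk.\<close>

lemma walk_prob_sym: "vmeas w x * walk_prob n x y = vmeas w y * walk_prob n y x"
  using inner_vm_funpow_avg[of "indicator {x}" "indicator {y}" n]
  by (simp add: walk_prob_def inner_vm_indicator inner_vm_commute[of "indicator {x}"])

lemma walk_prob_has_sum: "((\<lambda>y. walk_prob n x y) has_sum 1) UNIV"
proof (induction n arbitrary: x)
  case 0
  show ?case by (rule has_sum_finite_neutralI[of "{x}"]) (auto simp: walk_prob_0)
next
  case (Suc n)
  have "((\<lambda>y. \<Sum>z\<in>nbrs x. w x z / vmeas w x * walk_prob n z y) has_sum (\<Sum>z\<in>nbrs x. w x z / vmeas w x * 1)) UNIV"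
    by (intro has_sum_sum has_sum_cmult_right Suc) simp
  moreover have "(\<Sum>z\<in>nbrs x. w x z / vmeas w x * 1) = 1"
    using vmeas_pos[of x] by (simp add: sum_divide_distrib[symmetric] vmeas_eq_sum[symmetric])
  ultimately show ?case by (simp add: walk_prob_Suc sum_divide_distrib)
qed

text \<open>The walk can reduce the \<open>\<ell>\<^sup>1\<close>-distance to \<open>y\<close> by one in each step.\<close>

lemma walk_prob_pos:
  obtains n where "0 < walk_prob n x y"
proof -
  have "\<exists>n. 0 < walk_prob n x y"
  proof (induction "nat (\<Sum>i\<in>UNIV. \<bar>x $ i - y $ i\<bar>)" arbitrary: x rule: less_induct)
    case less
    show ?case
    proof (cases "x = y")
      case True
      thus ?thesis by (auto intro: exI[of _ 0] simp: walk_prob_0)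
    next
      case False
      then obtain i where i: "x $ i \<noteq> y $ i" by (auto simp: vec_eq_iff)
      define z where "z = (\<chi> j. if j = i then x $ i + sgn (y $ i - x $ i) else x $ j)"
      have "(\<Sum>j\<in>UNIV. \<bar>x $ j - z $ j\<bar>) = (\<Sum>j\<in>UNIV. if j = i then 1 else 0)"
        using i by (intro sum.cong) (auto simp: z_def sgn_if)
      hence z: "z \<in> nbrs x" by (simp add: nbrs_def lattice_adj_def)
      have "(\<Sum>j\<in>UNIV. \<bar>z $ j - y $ j\<bar>) < (\<Sum>j\<in>UNIV. \<bar>x $ j - y $ j\<bar>)"
        using i by (intro sum_strict_mono_ex1) (auto simp: z_def sgn_if intro!: exI[of _ i])
      moreover have "0 \<le> (\<Sum>j\<in>UNIV. \<bar>z $ j - y $ j\<bar>)" by (simp add: sum_nonneg)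
      ultimately have "nat (\<Sum>j\<in>UNIV. \<bar>z $ j - y $ j\<bar>) < nat (\<Sum>j\<in>UNIV. \<bar>x $ j - y $ j\<bar>)"
        by linarith
      hence "\<exists>n. 0 < walk_prob n z y" by (rule less)
      then obtain n where n: "0 < walk_prob n z y" ..
      have "0 < (\<Sum>z\<in>nbrs x. w x z * walk_prob n z y)"
        using z n weight_pos[OF z] weight_nonneg walk_prob_nonneg
        by (intro sum_pos2[of _ z]) auto
      hence "0 < walk_prob (Suc n) x y" using vmeas_pos by (simp add: walk_prob_Suc)
      thus ?thesis ..
    qed
  qed
  thus ?thesis using that by blast
qed

section \<open>Decay of the transition probabilities\<close>

lemma mem_nbrs_axis:
  "z + axis i 1 \<in> nbrs z" "z - axis i 1 \<in> nbrs z"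
  by (simp_all add: nbrs_def lattice_adj_def axis_def if_distrib[of abs] cong: if_cong)

text \<open>\<open>\<parallel>f\<parallel>\<^sup>2 - \<parallel>P f\<parallel>\<^sup>2\<close> is the sum over \<open>z\<close> of the variances of \<open>f\<close> on the neighbours of \<open>z\<close>, multiplied by \<open>\<mu> z\<close>.
  Two of these neighbours are \<open>z + e\<^sub>i\<close> and \<open>z - e\<^sub>i\<close>, of weight at least \<open>c\<close> each, and such a pair
  contributes at least \<open>c / 2\<close> times the square of the difference of its values. The points are at distance
  two because \<open>\<parallel>f\<parallel>\<^sup>2 - \<parallel>P f\<parallel>\<^sup>2\<close> is the Dirichlet form of the two-step walk \<open>P\<^sup>2\<close>.\<close>

lemma dirichlet_lower_bound:
  assumes f: "finsupp f" and c: "0 \<le> c" "\<And>x y. y \<in> nbrs x \<Longrightarrow> c \<le> w x y" and "finite A"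
  shows "c / 2 * (\<Sum>z\<in>A. (f (z + axis i 1) - f (z - axis i 1))\<^sup>2)
           \<le> inner_vm f f - inner_vm (avg f) (avg f)"
proof -
  define S where "S = {x. f x \<noteq> 0}"
  define B where "B = A \<union> S \<union> (\<Union>x\<in>S. nbrs x) \<union> {x. avg f x \<noteq> 0}"
  have S: "finite S" using f by (simp add: S_def finsupp_def)
  have B: "finite B" using S \<open>finite A\<close> finsupp_avg[OF f] by (simp add: B_def finsupp_def)
  have v: "vmeas w x > 0" for x by (rule vmeas_pos)
  have fS: "finsupp (\<lambda>x. (f x)\<^sup>2)" using S by (simp add: finsupp_def S_def)
  have ind: "finsupp (indicator B)" using B by (simp add: finsupp_def indicator_def)
  \<comment> \<open>On \<open>S\<close> the average of the indicator of \<open>B\<close> is \<open>1\<close>, since \<open>B\<close> contains all neighbours.\<close>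
  have "inner_vm f f = (\<Sum>x\<in>S. vmeas w x * (f x)\<^sup>2)"
    using S by (subst inner_vm_eq_sum[of S]) (auto simp: S_def power2_eq_square)
  also have "\<dots> = inner_vm (\<lambda>x. (f x)\<^sup>2) (avg (indicator B))"
  proof -
    have "avg (indicator B) x = 1" if "x \<in> S" for x
      using that by (intro avg_const) (auto simp: B_def indicator_def)
    thus ?thesis using S by (subst inner_vm_eq_sum[of S]) (auto simp: S_def)
  qed
  also have "\<dots> = inner_vm (avg (\<lambda>x. (f x)\<^sup>2)) (indicator B)"
    by (rule inner_vm_avg[symmetric, OF fS ind])
  also have "\<dots> = (\<Sum>z\<in>B. vmeas w z * avg (\<lambda>x. (f x)\<^sup>2) z)"
    using B by (subst inner_vm_eq_sum[of B]) auto
  finally have 1: "inner_vm f f = \<dots>" .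
  have 2: "inner_vm (avg f) (avg f) = (\<Sum>z\<in>B. vmeas w z * (avg f z)\<^sup>2)"
    using B by (subst inner_vm_eq_sum[of B]) (auto simp: B_def power2_eq_square)
  \<comment> \<open>The right-hand side is the variance of \<open>f\<close> over the neighbours of \<open>z\<close>, times \<open>\<mu> z\<close>.\<close>
  have var: "c / 2 * (f (z + axis i 1) - f (z - axis i 1))\<^sup>2
      \<le> vmeas w z * avg (\<lambda>x. (f x)\<^sup>2) z - vmeas w z * (avg f z)\<^sup>2" for z
  proof -
    define m where "m = avg f z"
    define g where "g y = w z y * (f y - m)\<^sup>2" for y
    let ?p = "z + axis i 1" and ?q = "z - axis i 1"
    have m: "(\<Sum>y\<in>nbrs z. w z y * f y) = vmeas w z * m"
      using v[of z] by (simp add: m_def avg_def)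
    have "(\<Sum>y\<in>nbrs z. g y)
        = (\<Sum>y\<in>nbrs z. w z y * (f y)\<^sup>2) - 2 * m * (\<Sum>y\<in>nbrs z. w z y * f y) + m\<^sup>2 * (\<Sum>y\<in>nbrs z. w z y)"
      unfolding g_def sum_distrib_left sum_subtractf[symmetric] sum.distrib[symmetric]
      by (intro sum.cong refl) (simp add: power2_eq_square algebra_simps)
    also have "\<dots> = vmeas w z * avg (\<lambda>x. (f x)\<^sup>2) z - vmeas w z * (avg f z)\<^sup>2"
      using v[of z] by (simp add: m vmeas_eq_sum[symmetric] m_def[symmetric] power2_eq_square)
        (simp add: avg_def)
    finally have eq: "(\<Sum>y\<in>nbrs z. g y) = \<dots>" .
    have pq: "?p \<noteq> ?q" by (auto simp: vec_eq_iff axis_def)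
    have nn: "0 \<le> g y" for y using weight_nonneg by (simp add: g_def)
    have "c / 2 * (f ?p - f ?q)\<^sup>2 \<le> c * (f ?p - m)\<^sup>2 + c * (f ?q - m)\<^sup>2"
    proof -
      have "(f ?p - f ?q)\<^sup>2 \<le> 2 * ((f ?p - m)\<^sup>2 + (f ?q - m)\<^sup>2)"
        using zero_le_power2[of "(f ?p - m) + (f ?q - m)"] by (simp add: power2_eq_square algebra_simps)
      from mult_left_mono[OF this c(1)] show ?thesis by (simp add: algebra_simps)
    qed
    also have "\<dots> \<le> g ?p + g ?q"
      unfolding g_def using c(2)[OF mem_nbrs_axis(1)] c(2)[OF mem_nbrs_axis(2)]
      by (intro add_mono mult_right_mono) auto
    also have "\<dots> = sum g {?p, ?q}" using pq by simp
    also have "\<dots> \<le> (\<Sum>y\<in>nbrs z. g y)"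
      using nn mem_nbrs_axis by (intro sum_mono2) auto
    finally show ?thesis by (simp add: eq)
  qed
  have "c / 2 * (\<Sum>z\<in>A. (f (z + axis i 1) - f (z - axis i 1))\<^sup>2)
      \<le> c / 2 * (\<Sum>z\<in>B. (f (z + axis i 1) - f (z - axis i 1))\<^sup>2)"
    using B c(1) by (intro mult_left_mono sum_mono2) (auto simp: B_def)
  also have "\<dots> \<le> (\<Sum>z\<in>B. vmeas w z * avg (\<lambda>x. (f x)\<^sup>2) z - vmeas w z * (avg f z)\<^sup>2)"
    unfolding sum_distrib_left by (intro sum_mono var)
  also have "\<dots> = inner_vm f f - inner_vm (avg f) (avg f)"
    by (simp add: 1 2 sum_subtractf)
  finally show ?thesis .
qed

lemma inner_vm_avg_le: "finsupp f \<Longrightarrow> inner_vm (avg f) (avg f) \<le> inner_vm f f"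
  using dirichlet_lower_bound[of f 0 "{}"] weight_nonneg by simp

text \<open>On the half-line \<open>a k = x + 2 k e\<^sub>i\<close> the function \<open>f\<close> vanishes eventually, so \<open>(f x)\<^sup>2\<close> is a telescoping
  sum of the terms \<open>(f (a k) - f (a (Suc k))) * (f (a k) + f (a (Suc k)))\<close>. The Cauchy-Schwarz inequality
  separates the differences, which \<open>dirichlet_lower_bound\<close> controls, from the sums, which \<open>\<parallel>f\<parallel>\<close> controls.\<close>

lemma quartic_pointwise_bound:
  assumes f: "finsupp f"
    and c: "0 < c" "\<And>x y. y \<in> nbrs x \<Longrightarrow> c \<le> w x y" and m: "0 < m" "\<And>x. m \<le> vmeas w x"
  shows "f x ^ 4 \<le> 8 / (c * m) * (inner_vm f f - inner_vm (avg f) (avg f)) * inner_vm f f"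
proof -
  fix i :: 'd
  define a where "a k = x + axis i (2 * int k)" for k
  define z where "z k = x + axis i (2 * int k + 1)" for k
  have injs: "inj a" "inj z" by (auto simp: inj_def a_def z_def vec_eq_iff axis_def)
  have za: "z k + axis i 1 = a (Suc k)" "z k - axis i 1 = a k" for k
    by (auto simp: a_def z_def vec_eq_iff axis_def)
  have "finite {k. f (a k) \<noteq> 0}"
    using finite_vimageI[of "{x. f x \<noteq> 0}" a] f injs by (simp add: finsupp_def vimage_def)
  then obtain M where M: "f (a M) = 0"
    using infinite_UNIV_nat by (metis (mono_tags, lifting) UNIV_eq_I mem_Collect_eq)
  have fin: "finite {x. f x \<noteq> 0}" using f by (simp add: finsupp_def)
  have sq: "m * (\<Sum>k<M. (f (h k))\<^sup>2) \<le> inner_vm f f" if "inj h" for h :: "nat \<Rightarrow> _"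
  proof -
    let ?B = "h ` {..<M} \<union> {x. f x \<noteq> 0}"
    have "m * (\<Sum>k<M. (f (h k))\<^sup>2) = (\<Sum>y\<in>h ` {..<M}. m * (f y)\<^sup>2)"
      using that by (subst sum.reindex) (auto simp: sum_distrib_left inj_def inj_on_def)
    also have "\<dots> \<le> (\<Sum>y\<in>?B. m * (f y)\<^sup>2)"
      using fin m by (intro sum_mono2) auto
    also have "\<dots> \<le> (\<Sum>y\<in>?B. vmeas w y * (f y * f y))"
      unfolding power2_eq_square using m by (intro sum_mono mult_right_mono) auto
    also have "\<dots> = inner_vm f f" using fin by (subst inner_vm_eq_sum[of ?B]) auto
    finally show ?thesis .
  qed
  define d where "d k = f (a (Suc k)) - f (a k)" for k
  define s where "s k = f (a (Suc k)) + f (a k)" for k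
  have "(f x)\<^sup>2 = - (\<Sum>k<M. (f (a (Suc k)))\<^sup>2 - (f (a k))\<^sup>2)"
    using M by (subst sum_lessThan_telescope) (simp add: a_def axis_def vec_eq_iff zero_vec_def[symmetric])
  hence "(f x)\<^sup>2 = - (\<Sum>k<M. d k * s k)"
    by (simp add: d_def s_def power2_eq_square algebra_simps)
  hence "f x ^ 4 = (\<Sum>k<M. d k * s k)\<^sup>2"
    by (metis power2_minus power_even_eq numeral_Bit0 mult_2 power_mult)
  also have "\<dots> \<le> (\<Sum>k<M. (d k)\<^sup>2) * (\<Sum>k<M. (s k)\<^sup>2)"
    by (rule Cauchy_Schwarz_ineq_sum)
  also have "\<dots> \<le> (2 / c * (inner_vm f f - inner_vm (avg f) (avg f))) * (4 / m * inner_vm f f)"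
  proof (intro mult_mono)
    have "(\<Sum>k<M. (d k)\<^sup>2) = (\<Sum>z\<in>z ` {..<M}. (f (z + axis i 1) - f (z - axis i 1))\<^sup>2)"
      using injs by (subst sum.reindex) (auto simp: za d_def inj_def inj_on_def)
    with dirichlet_lower_bound[OF f less_imp_le[OF c(1)] c(2), of "z ` {..<M}" i] c(1)
    show "(\<Sum>k<M. (d k)\<^sup>2) \<le> 2 / c * (inner_vm f f - inner_vm (avg f) (avg f))"
      by (simp add: field_simps)
    have "(\<Sum>k<M. (s k)\<^sup>2) \<le> (\<Sum>k<M. 2 * (f (a (Suc k)))\<^sup>2 + 2 * (f (a k))\<^sup>2)"
    proof (intro sum_mono)
      fix k show "(s k)\<^sup>2 \<le> 2 * (f (a (Suc k)))\<^sup>2 + 2 * (f (a k))\<^sup>2"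
        using zero_le_power2[of "d k"] unfolding s_def d_def by (simp add: power2_eq_square algebra_simps)
    qed
    also have "\<dots> = 2 * (\<Sum>k<M. (f (a (Suc k)))\<^sup>2) + 2 * (\<Sum>k<M. (f (a k))\<^sup>2)"
      by (simp add: sum.distrib sum_distrib_left)
    also have "\<dots> \<le> 4 / m * inner_vm f f"
    proof -
      have "inj (\<lambda>k. a (Suc k))" using injs by (auto simp: inj_def)
      from sq[OF this] sq[OF injs(1)] m(1) show ?thesis by (simp add: field_simps)
    qed
    finally show "(\<Sum>k<M. (s k)\<^sup>2) \<le> 4 / m * inner_vm f f" .
    show "0 \<le> 2 / c * (inner_vm f f - inner_vm (avg f) (avg f))"
      using c inner_vm_avg_le[OF f] by simp
  qed (simp add: sum_nonneg)
  also have "\<dots> = 8 / (c * m) * (inner_vm f f - inner_vm (avg f) (avg f)) * inner_vm f f"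
    by simp
  finally show ?thesis .
qed

text \<open>With \<open>f\<^sub>n = P\<^sup>n 1\<^sub>y\<close>, the energies \<open>D n = \<parallel>f\<^sub>n\<parallel>\<^sup>2 - \<parallel>f\<^sub>n\<^sub>+\<^sub>1\<parallel>\<^sup>2\<close> are nonnegative with \<open>\<Sum>n. D n \<le> \<mu> y\<close>. They
  decrease, because \<open>D n - D (Suc n) = \<parallel>f\<^sub>n - f\<^sub>n\<^sub>+\<^sub>2\<parallel>\<^sup>2\<close> by self-adjointness of \<open>P\<close>. Hence
  \<open>D n \<le> \<mu> y / Suc n\<close>, and \<open>quartic_pointwise_bound\<close> applies to \<open>f\<^sub>n\<close>.\<close>

lemma walk_prob_decay:
  obtains C where "0 \<le> C" "\<And>n x. walk_prob n x y \<le> C * real (Suc n) powr (-1/4)"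
proof -
  obtain c where c: "0 < c" "\<And>x y. y \<in> nbrs x \<Longrightarrow> c \<le> w x y" using weight_lower_bound by blast
  obtain m where m: "0 < m" "\<And>x. m \<le> vmeas w x" using vmeas_lower_bound by blast
  define f where "f n = (avg ^^ n) (indicator {y} :: int ^ 'd \<Rightarrow> real)" for n
  define N where "N n = inner_vm (f n) (f n)" for n
  have fin: "finsupp (f n)" for n by (simp add: f_def)
  have f_Suc: "f (Suc n) = avg (f n)" for n by (simp add: f_def)
  have N0: "N 0 = vmeas w y" by (simp add: N_def f_def inner_vm_indicator)
  have N_nonneg: "0 \<le> N n" for n by (simp add: N_def inner_vm_nonneg)
  have N_Suc: "N (Suc n) \<le> N n" for n
    using inner_vm_avg_le[OF fin] by (simp add: N_def f_Suc)
  have N_le: "N n \<le> vmeas w y" for n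
    using lift_Suc_antimono_le[of N 0 n] N_Suc N0 by simp
  define D where "D n = N n - N (Suc n)" for n
  have D_decr: "D (Suc n) \<le> D n" for n
  proof -
    define B where "B = {x. f n x \<noteq> 0} \<union> {x. f (Suc n) x \<noteq> 0} \<union> {x. f (Suc (Suc n)) x \<noteq> 0}"
    have B: "finite B" using fin by (simp add: B_def finsupp_def)
    have cross: "inner_vm (f n) (f (Suc (Suc n))) = N (Suc n)"
      using inner_vm_avg[OF fin[of n] fin[of "Suc n"]] by (simp add: N_def f_Suc)
    have "0 \<le> (\<Sum>x\<in>B. vmeas w x * (f n x - f (Suc (Suc n)) x)\<^sup>2)"
      using vmeas_pos by (intro sum_nonneg) (simp add: less_imp_le)
    also have "\<dots> = (\<Sum>x\<in>B. vmeas w x * (f n x * f n x)) + (\<Sum>x\<in>B. vmeas w x * (f (Suc (Suc n)) x * f (Suc (Suc n)) x))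
        - 2 * (\<Sum>x\<in>B. vmeas w x * (f n x * f (Suc (Suc n)) x))"
      unfolding sum_distrib_left sum_subtractf[symmetric] sum.distrib[symmetric]
      by (intro sum.cong refl) (simp add: power2_eq_square algebra_simps)
    also have "\<dots> = inner_vm (f n) (f n) + inner_vm (f (Suc (Suc n))) (f (Suc (Suc n)))
        - 2 * inner_vm (f n) (f (Suc (Suc n)))"
    proof -
      have "inner_vm (f j) (f k) = (\<Sum>x\<in>B. vmeas w x * (f j x * f k x))"
        if "j \<in> {n, Suc n, Suc (Suc n)}" for j k
        using that B by (intro inner_vm_eq_sum) (auto simp: B_def)
      thus ?thesis by simp
    qed
    also have "\<dots> = D n - D (Suc n)" unfolding cross by (simp add: D_def N_def)
    finally show ?thesis by simp
  qed
  have D_nonneg: "0 \<le> D n" for n using N_Suc by (simp add: D_def)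
  have D_le: "D n \<le> vmeas w y / real (Suc n)" for n
  proof -
    have "real (Suc n) * D n = (\<Sum>k\<le>n. D n)" by simp
    also have "\<dots> \<le> (\<Sum>k\<le>n. D k)"
      using lift_Suc_antimono_le[of D] D_decr by (intro sum_mono) simp
    also have "\<dots> = N 0 - N (Suc n)" unfolding D_def by (rule sum_telescope)
    also have "\<dots> \<le> vmeas w y" using N0 N_nonneg[of "Suc n"] by simp
    finally show ?thesis by (simp add: field_simps)
  qed
  define K where "K = 8 / (c * m) * (vmeas w y)\<^sup>2"
  have K: "0 \<le> K" using c m by (simp add: K_def)
  have "walk_prob n x y \<le> K powr (1/4) * real (Suc n) powr (-1/4)" for n x
  proof -
    have "walk_prob n x y ^ 4 \<le> 8 / (c * m) * D n * N n"
      using quartic_pointwise_bound[OF fin[of n] c m, of x]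
      by (simp add: D_def N_def f_Suc walk_prob_def f_def)
    also have "\<dots> \<le> 8 / (c * m) * (vmeas w y / real (Suc n)) * vmeas w y"
      using D_le[of n] N_le[of n] N_nonneg[of n] c m vmeas_pos[of y] by (intro mult_mono mult_left_mono) auto
    also have "\<dots> = K / real (Suc n)" by (simp add: K_def power2_eq_square)
    finally have "(walk_prob n x y ^ 4) powr (1/4) \<le> (K / real (Suc n)) powr (1/4)"
      using walk_prob_nonneg by (intro powr_mono2) auto
    moreover have "(walk_prob n x y ^ 4) powr (1/4) = walk_prob n x y"
      using walk_prob_nonneg[of n x y] by (cases "walk_prob n x y = 0") (auto simp: powr_realpow[symmetric] powr_powr simp del: powr_numeral)
    moreover have "(K / real (Suc n)) powr (1/4) = K powr (1/4) * real (Suc n) powr (-1/4)"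
      using K by (simp add: powr_divide powr_minus_divide)
    ultimately show ?thesis by simp
  qed
  thus ?thesis using that[of "K powr (1/4)"] by simp
qed

section \<open>The heat kernel as a Poissonised random walk\<close>

text \<open>The binomial theorem for \<open>(P - 1)\<^sup>n\<close>.\<close>

lemma laplacian_funpow_eq:
  "(laplacian w ^^ n) f x = (\<Sum>k\<le>n. real (n choose k) * (-1) ^ (n - k) * (avg ^^ k) f x)"
proof (induction n arbitrary: x)
  case (Suc n)
  define g where "g k = (avg ^^ k) f x" for k
  have IH: "(laplacian w ^^ n) f = (\<lambda>x. \<Sum>k\<le>n. real (n choose k) * (-1) ^ (n - k) * (avg ^^ k) f x)"
    using Suc by blast
  have "(laplacian w ^^ Suc n) f x
      = (\<Sum>k\<le>n. real (n choose k) * (-1) ^ (n - k) * g (Suc k)) - (\<Sum>k\<le>n. real (n choose k) * (-1) ^ (n - k) * g k)"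
    by (simp add: laplacian_eq_avg IH avg_sum avg_cmult g_def)
  also have "(\<Sum>k\<le>n. real (n choose k) * (-1) ^ (n - k) * g k) = (\<Sum>k\<le>Suc n. real (n choose k) * (-1) ^ (n - k) * g k)"
    by simp
  also have "\<dots> = (-1) ^ n * g 0 + (\<Sum>k\<le>n. real (n choose Suc k) * (-1) ^ (n - Suc k) * g (Suc k))"
    by (subst sum.atMost_Suc_shift) simp
  also have "(\<Sum>k\<le>n. real (n choose k) * (-1) ^ (n - k) * g (Suc k)) - \<dots>
      = (-1) ^ Suc n * g 0 + (\<Sum>k\<le>n. real (n choose k) * (-1) ^ (n - k) * g (Suc k)
          - real (n choose Suc k) * (-1) ^ (n - Suc k) * g (Suc k))"
    by (simp add: sum_subtractf)
  also have "(\<Sum>k\<le>n. real (n choose k) * (-1) ^ (n - k) * g (Suc k) - real (n choose Suc k) * (-1) ^ (n - Suc k) * g (Suc k))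
     = (\<Sum>k\<le>n. real (Suc n choose Suc k) * (-1) ^ (n - k) * g (Suc k))"
  proof (intro sum.cong refl)
    fix k assume "k \<in> {..n}"
    show "real (n choose k) * (-1) ^ (n - k) * g (Suc k) - real (n choose Suc k) * (-1) ^ (n - Suc k) * g (Suc k)
      = real (Suc n choose Suc k) * (-1) ^ (n - k) * g (Suc k)"
    proof (cases "k = n")
      case False
      hence "n - k = Suc (n - Suc k)" using \<open>k \<in> {..n}\<close> by auto
      thus ?thesis by (simp add: algebra_simps)
    qed simp
  qed
  also have "(-1) ^ Suc n * g 0 + \<dots> = (\<Sum>k\<le>Suc n. real (Suc n choose k) * (-1) ^ (Suc n - k) * g k)"
    by (simp add: sum.atMost_Suc_shift del: sum.atMost_Suc binomial_Suc_Suc)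
  finally show ?case by (simp only: g_def)
qed simp

lemma summable_walk_series: "summable (\<lambda>n. t ^ n / fact n * walk_prob n x y)"
proof (rule summable_comparison_test')
  show "summable (\<lambda>n. \<bar>t\<bar> ^ n / fact n)" using summable_exp[of "\<bar>t\<bar>"] by (simp add: divide_inverse mult.commute)
  show "norm (t ^ n / fact n * walk_prob n x y) \<le> \<bar>t\<bar> ^ n / fact n" if "0 \<le> n" for n
    using mult_left_mono[OF walk_prob_le_1, of "\<bar>t\<bar> ^ n / fact n" n x y]
    by (simp add: abs_mult power_abs walk_prob_nonneg)
qed

text \<open>The Cauchy product of the series for \<open>exp (t P)\<close> and \<open>exp (- t)\<close> is the series for
  \<open>exp (t (P - 1))\<close>.\<close>

lemma laplacian_series_sums:
  "(\<lambda>n. t ^ n / fact n * (laplacian w ^^ n) (indicator {y}) x) sums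
     (exp (- t) * (\<Sum>n. t ^ n / fact n * walk_prob n x y))"
proof -
  define p where "p k = t ^ k / fact k * walk_prob k x y" for k
  define e where "e k = (- t) ^ k / fact k" for k
  have "summable (\<lambda>k. norm (p k))"
    using summable_walk_series[of "\<bar>t\<bar>" x y] by (simp add: p_def abs_mult power_abs walk_prob_nonneg)
  moreover have "summable (\<lambda>k. norm (e k))"
    using summable_exp[of "\<bar>t\<bar>"] by (simp add: e_def abs_mult power_abs divide_inverse mult.commute)
  ultimately have "(\<lambda>n. \<Sum>k\<le>n. p k * e (n - k)) sums ((\<Sum>k. p k) * (\<Sum>k. e k))"
    by (rule Cauchy_product_sums)
  moreover have "(\<Sum>k. e k) = exp (- t)"
    by (simp add: e_def exp_def divide_inverse mult.commute scaleR_conv_of_real)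
  moreover have "(\<Sum>k\<le>n. p k * e (n - k)) = t ^ n / fact n * (laplacian w ^^ n) (indicator {y}) x" for n
    unfolding laplacian_funpow_eq sum_distrib_left
  proof (intro sum.cong refl)
    fix k assume "k \<in> {..n}"
    hence "t ^ n = t ^ k * t ^ (n - k)" "real (n choose k) = fact n / (fact k * fact (n - k))"
      by (simp_all add: power_add[symmetric] binomial_fact)
    moreover have "(- t) ^ (n - k) = (-1) ^ (n - k) * t ^ (n - k)" by (rule power_minus)
    ultimately show "p k * e (n - k) = t ^ n / fact n * (real (n choose k) * (-1) ^ (n - k) * (avg ^^ k) (indicator {y}) x)"
      by (simp add: p_def e_def walk_prob_def)
  qed
  ultimately show ?thesis by (simp add: p_def mult.commute)
qed

lemma laplacian_funpow_l1_bound: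
  assumes "finite A"
  shows "(\<Sum>x\<in>A. vmeas w x * \<bar>(laplacian w ^^ n) (indicator {y}) x\<bar>) \<le> 2 ^ n * vmeas w y"
proof -
  have "vmeas w x * \<bar>(laplacian w ^^ n) (indicator {y}) x\<bar>
      \<le> (\<Sum>k\<le>n. real (n choose k) * (vmeas w y * walk_prob k y x))" for x
  proof -
    have "\<bar>(laplacian w ^^ n) (indicator {y}) x\<bar> \<le> (\<Sum>k\<le>n. real (n choose k) * walk_prob k x y)"
      unfolding laplacian_funpow_eq walk_prob_def[symmetric]
      by (rule order_trans[OF sum_abs]) (simp add: abs_mult power_abs walk_prob_nonneg)
    hence "vmeas w x * \<bar>(laplacian w ^^ n) (indicator {y}) x\<bar> \<le> vmeas w x * (\<Sum>k\<le>n. real (n choose k) * walk_prob k x y)"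
      using vmeas_pos[of x] by simp
    also have "\<dots> = (\<Sum>k\<le>n. real (n choose k) * (vmeas w x * walk_prob k x y))"
      by (simp add: sum_distrib_left mult.left_commute)
    finally show ?thesis by (simp only: walk_prob_sym[of x])
  qed
  hence "(\<Sum>x\<in>A. vmeas w x * \<bar>(laplacian w ^^ n) (indicator {y}) x\<bar>)
      \<le> (\<Sum>x\<in>A. \<Sum>k\<le>n. real (n choose k) * (vmeas w y * walk_prob k y x))"
    by (intro sum_mono)
  also have "\<dots> = (\<Sum>k\<le>n. real (n choose k) * (vmeas w y * (\<Sum>x\<in>A. walk_prob k y x)))"
    by (subst sum.swap) (simp add: sum_distrib_left)
  also have "\<dots> \<le> (\<Sum>k\<le>n. real (n choose k) * (vmeas w y * 1))"
  proof (intro sum_mono mult_left_mono)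
    fix k
    show "(\<Sum>x\<in>A. walk_prob k y x) \<le> 1"
      by (rule finite_sum_le_has_sum[OF walk_prob_has_sum]) (use assms walk_prob_nonneg in auto)
  qed (use vmeas_pos[of y] in auto)
  also have "\<dots> = 2 ^ n * vmeas w y"
    by (simp add: sum_distrib_right[symmetric] choose_row_sum flip: of_nat_sum)
  finally show ?thesis .
qed

text \<open>Since \<open>\<mu>\<close> is bounded below, the \<open>\<ell>\<^sup>2(\<mu>)\<close> norm is dominated by the \<open>\<ell>\<^sup>1(\<mu>)\<close> norm. This gives convergence of
  the exponential series in \<open>\<ell>\<^sup>2(\<mu>)\<close> from termwise \<open>\<ell>\<^sup>1(\<mu>)\<close> estimates.\<close>

lemma ell2_l1_bound:
  assumes m: "0 < m" "\<And>x. m \<le> vmeas w x"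
    and r: "\<And>A. finite A \<Longrightarrow> (\<Sum>x\<in>A. vmeas w x * \<bar>g x\<bar>) \<le> r"
  shows "g \<in> ell2 (vmeas w)" "ell2_norm (vmeas w) g \<le> r / sqrt m"
proof -
  have r0: "0 \<le> r" using r[of "{}"] by simp
  have bound: "(\<Sum>x\<in>A. (g x)\<^sup>2 * vmeas w x) \<le> (r / sqrt m)\<^sup>2" if A: "finite A" for A
  proof -
    have nn: "0 \<le> vmeas w x * \<bar>g x\<bar>" for x using vmeas_pos[of x] by simp
    have "m * (\<Sum>x\<in>A. (g x)\<^sup>2 * vmeas w x) \<le> (\<Sum>x\<in>A. vmeas w x * \<bar>g x\<bar> * (vmeas w x * \<bar>g x\<bar>))"
      unfolding sum_distrib_left
    proof (intro sum_mono)
      fix x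
      have "m * ((g x)\<^sup>2 * vmeas w x) \<le> vmeas w x * ((g x)\<^sup>2 * vmeas w x)"
        using m(2)[of x] vmeas_pos[of x] by (intro mult_right_mono) auto
      also have "\<dots> = vmeas w x * \<bar>g x\<bar> * (vmeas w x * \<bar>g x\<bar>)"
        by (simp add: power2_eq_square)
      finally show "m * ((g x)\<^sup>2 * vmeas w x) \<le> \<dots>" .
    qed
    also have "\<dots> \<le> (\<Sum>x\<in>A. vmeas w x * \<bar>g x\<bar> * r)"
    proof (intro sum_mono mult_left_mono nn)
      fix x assume "x \<in> A"
      hence "vmeas w x * \<bar>g x\<bar> \<le> (\<Sum>x\<in>A. vmeas w x * \<bar>g x\<bar>)"
        using A nn by (intro member_le_sum) auto
      thus "vmeas w x * \<bar>g x\<bar> \<le> r" using r[OF A] by simp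
    qed
    also have "\<dots> \<le> r * r" unfolding sum_distrib_right[symmetric] using r[OF A] r0 by (rule mult_right_mono)
    finally show ?thesis using m(1) by (simp add: power_divide field_simps power2_eq_square)
  qed
  have summ: "(\<lambda>x. (g x)\<^sup>2 * vmeas w x) summable_on UNIV"
    using bound vmeas_pos
    by (intro nonneg_bdd_above_summable_on bdd_aboveI[of _ "(r / sqrt m)\<^sup>2"]) (auto simp: less_imp_le)
  thus "g \<in> ell2 (vmeas w)" by (simp add: ell2_def)
  have "(\<Sum>\<^sub>\<infinity>x. (g x)\<^sup>2 * vmeas w x) \<le> (r / sqrt m)\<^sup>2"
    by (rule infsum_le_finite_sums[OF summ]) (use bound in auto)
  hence "ell2_norm (vmeas w) g \<le> sqrt ((r / sqrt m)\<^sup>2)"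
    unfolding ell2_norm_def by (rule real_sqrt_le_mono)
  also have "\<dots> = r / sqrt m" using r0 m(1) by simp
  finally show "ell2_norm (vmeas w) g \<le> r / sqrt m" .
qed

lemma ell2_diff:
  assumes "f \<in> ell2 (vmeas w)" "g \<in> ell2 (vmeas w)"
  shows "(\<lambda>x. f x - g x) \<in> ell2 (vmeas w)"
proof -
  have "(\<lambda>x. 2 * ((f x)\<^sup>2 * vmeas w x) + 2 * ((g x)\<^sup>2 * vmeas w x)) summable_on UNIV"
    using assms by (intro summable_on_add summable_on_cmult_right) (auto simp: ell2_def)
  moreover have "(f x - g x)\<^sup>2 * vmeas w x \<le> 2 * ((f x)\<^sup>2 * vmeas w x) + 2 * ((g x)\<^sup>2 * vmeas w x)" for x
  proof -
    have "(f x - g x)\<^sup>2 \<le> 2 * (f x)\<^sup>2 + 2 * (g x)\<^sup>2"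
      using zero_le_power2[of "f x + g x"] by (simp add: power2_eq_square algebra_simps)
    from mult_right_mono[OF this, of "vmeas w x"] show ?thesis
      using vmeas_pos[of x] by (simp add: algebra_simps)
  qed
  ultimately show ?thesis unfolding ell2_def using vmeas_pos
    by (auto intro: summable_on_comparison_test simp: less_imp_le)
qed

lemma ell2_pointwise_bound:
  assumes "g \<in> ell2 (vmeas w)"
  shows "\<bar>g x\<bar> * sqrt (vmeas w x) \<le> ell2_norm (vmeas w) g"
proof -
  have "(g x)\<^sup>2 * vmeas w x \<le> (\<Sum>\<^sub>\<infinity>x. (g x)\<^sup>2 * vmeas w x)"
    using finite_sum_le_infsum[of "\<lambda>x. (g x)\<^sup>2 * vmeas w x" UNIV "{x}"] assms vmeas_pos
    by (simp add: ell2_def less_imp_le)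
  hence "sqrt ((g x)\<^sup>2 * vmeas w x) \<le> ell2_norm (vmeas w) g"
    unfolding ell2_norm_def by (rule real_sqrt_le_mono)
  thus ?thesis by (simp add: real_sqrt_mult)
qed

text \<open>The partial sums converge to the pointwise sum \<open>v\<close> in \<open>\<ell>\<^sup>1(\<mu>)\<close>, at the rate of the tail of
  \<open>exp (2 * \<bar>t\<bar>)\<close>, hence in \<open>\<ell>\<^sup>2(\<mu>)\<close>. The limit is unique because \<open>\<ell>\<^sup>2(\<mu>)\<close> convergence implies pointwise
  convergence.\<close>

lemma heat_semigroup_indicator:
  "heat_semigroup w t (indicator {y}) x = exp (- t) * (\<Sum>n. t ^ n / fact n * walk_prob n x y)"
proof -
  obtain m where m: "0 < m" "\<And>x. m \<le> vmeas w x" using vmeas_lower_bound by blast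
  define F where "F n = (laplacian w ^^ n) (indicator {y} :: int ^ 'd \<Rightarrow> real)" for n
  define S where "S N x = (\<Sum>n<N. t ^ n / fact n * F n x)" for N x
  define v where "v x = exp (- t) * (\<Sum>n. t ^ n / fact n * walk_prob n x y)" for x
  define e where "e n = (2 * \<bar>t\<bar>) ^ n / fact n" for n
  define r where "r N = vmeas w y * (\<Sum>n. e (n + N))" for N
  have sums: "(\<lambda>n. t ^ n / fact n * F n x) sums v x" for x
    unfolding F_def v_def by (rule laplacian_series_sums)
  have e: "summable e"
    using summable_exp[of "2 * \<bar>t\<bar>"] by (simp add: e_def[abs_def] divide_inverse mult.commute)
  have l1: "(\<Sum>x\<in>A. vmeas w x * \<bar>S N x - v x\<bar>) \<le> r N" if A: "finite A" for A N
  proof -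
    have term_bound: "(\<Sum>x\<in>A. vmeas w x * \<bar>t ^ n / fact n * F n x\<bar>) \<le> vmeas w y * e n" for n
    proof -
      have "(\<Sum>x\<in>A. vmeas w x * \<bar>t ^ n / fact n * F n x\<bar>) = \<bar>t\<bar> ^ n / fact n * (\<Sum>x\<in>A. vmeas w x * \<bar>F n x\<bar>)"
        by (simp add: sum_distrib_left abs_mult power_abs mult_ac)
      also have "\<dots> \<le> \<bar>t\<bar> ^ n / fact n * (2 ^ n * vmeas w y)"
        unfolding F_def by (intro mult_left_mono laplacian_funpow_l1_bound A) simp
      finally show ?thesis by (simp add: e_def power_mult_distrib mult_ac)
    qed
    have abs_summable: "summable (\<lambda>n. \<bar>t ^ n / fact n * F n x\<bar>)" for x
    proof (rule summable_comparison_test')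
      show "summable (\<lambda>n. vmeas w y * e n / vmeas w x)" using e by (intro summable_divide summable_mult)
      show "norm \<bar>t ^ n / fact n * F n x\<bar> \<le> vmeas w y * e n / vmeas w x" if "0 \<le> n" for n
      proof -
        have "vmeas w x * \<bar>t ^ n / fact n * F n x\<bar> \<le> vmeas w y * e n"
          using laplacian_funpow_l1_bound[of "{x}" n y]
          using mult_left_mono[of "vmeas w x * \<bar>F n x\<bar>" "2 ^ n * vmeas w y" "\<bar>t\<bar> ^ n / fact n"]
          by (simp add: F_def e_def power_mult_distrib abs_mult power_abs mult_ac)
        thus ?thesis using vmeas_pos[of x] by (simp add: field_simps)
      qed
    qed
    have "\<bar>S N x - v x\<bar> \<le> (\<Sum>n. \<bar>t ^ (n + N) / fact (n + N) * F (n + N) x\<bar>)" for x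
    proof -
      have "v x - S N x = (\<Sum>n. t ^ (n + N) / fact (n + N) * F (n + N) x)"
        using suminf_split_initial_segment[of "\<lambda>n. t ^ n / fact n * F n x" N] sums[of x]
        by (simp add: S_def sums_iff)
      moreover have "\<bar>\<dots>\<bar> \<le> (\<Sum>n. \<bar>t ^ (n + N) / fact (n + N) * F (n + N) x\<bar>)"
        by (rule summable_rabs, rule summable_ignore_initial_segment[OF abs_summable])
      ultimately show ?thesis by (simp add: abs_minus_commute)
    qed
    hence "(\<Sum>x\<in>A. vmeas w x * \<bar>S N x - v x\<bar>)
        \<le> (\<Sum>x\<in>A. vmeas w x * (\<Sum>n. \<bar>t ^ (n + N) / fact (n + N) * F (n + N) x\<bar>))"
      using vmeas_pos by (intro sum_mono mult_left_mono) (auto simp: less_imp_le)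
    also have "\<dots> = (\<Sum>x\<in>A. (\<Sum>n. vmeas w x * \<bar>t ^ (n + N) / fact (n + N) * F (n + N) x\<bar>))"
      by (intro sum.cong refl suminf_mult[symmetric] summable_ignore_initial_segment[OF abs_summable])
    also have "\<dots> = (\<Sum>n. \<Sum>x\<in>A. vmeas w x * \<bar>t ^ (n + N) / fact (n + N) * F (n + N) x\<bar>)"
      by (intro suminf_sum[symmetric] summable_mult summable_ignore_initial_segment[OF abs_summable])
    also have "\<dots> \<le> (\<Sum>n. vmeas w y * e (n + N))"
      by (intro suminf_le term_bound summable_sum summable_mult summable_ignore_initial_segment[OF abs_summable]
          summable_ignore_initial_segment[OF e])
    also have "\<dots> = r N"
      unfolding r_def by (intro suminf_mult summable_ignore_initial_segment[OF e])
    finally show ?thesis .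
  qed
  have r_lim: "r \<longlonglongrightarrow> 0"
  proof -
    have "(\<Sum>n. e (n + N)) = suminf e - sum e {..<N}" for N
      using suminf_split_initial_segment[OF e, of N] by simp
    hence "r = (\<lambda>N. vmeas w y * (suminf e - sum e {..<N}))" by (intro ext) (simp only: r_def)
    moreover have "\<dots> \<longlonglongrightarrow> vmeas w y * (suminf e - suminf e)"
      by (intro tendsto_intros summable_LIMSEQ e)
    ultimately show ?thesis by simp
  qed
  have lim: "(\<lambda>N. ell2_norm (vmeas w) (\<lambda>x. S N x - v x)) \<longlonglongrightarrow> 0"
  proof (rule tendsto_sandwich[OF _ _ tendsto_const])
    show "\<forall>\<^sub>F N in sequentially. ell2_norm (vmeas w) (\<lambda>x. S N x - v x) \<le> r N / sqrt m"
      by (intro always_eventually allI ell2_l1_bound(2)[OF m] l1)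
    show "(\<lambda>N. r N / sqrt m) \<longlonglongrightarrow> 0" using tendsto_divide[OF r_lim tendsto_const[of "sqrt m"]] m by simp
    show "\<forall>\<^sub>F N in sequentially. 0 \<le> ell2_norm (vmeas w) (\<lambda>x. S N x - v x)"
      unfolding ell2_norm_def using vmeas_pos
      by (intro always_eventually allI real_sqrt_ge_zero infsum_nonneg) (simp add: less_imp_le)
  qed
  have v: "v \<in> ell2 (vmeas w)"
  proof (rule ell2_l1_bound(1)[OF m])
    show "(\<Sum>x\<in>A. vmeas w x * \<bar>v x\<bar>) \<le> r 0" if "finite A" for A
      using l1[OF that, of 0] by (simp add: S_def)
  qed
  have S: "S N \<in> ell2 (vmeas w)" for N
    using ell2_diff[of "\<lambda>x. S N x - v x" "\<lambda>x. - v x"] ell2_l1_bound(1)[OF m l1, of N] v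
    by (simp add: ell2_def)
  have unique: "v' = v" if v': "v' \<in> ell2 (vmeas w)"
    and lim': "(\<lambda>N. ell2_norm (vmeas w) (\<lambda>x. S N x - v' x)) \<longlonglongrightarrow> 0" for v'
  proof
    fix x
    have "(\<lambda>N. S N x - v' x) \<longlonglongrightarrow> 0"
    proof (rule Lim_null_comparison)
      show "\<forall>\<^sub>F N in sequentially. norm (S N x - v' x) \<le> ell2_norm (vmeas w) (\<lambda>x. S N x - v' x) / sqrt (vmeas w x)"
        using ell2_pointwise_bound[OF ell2_diff[OF S v'], of _ x] vmeas_pos[of x]
        by (intro always_eventually allI) (simp add: field_simps)
      show "(\<lambda>N. ell2_norm (vmeas w) (\<lambda>x. S N x - v' x) / sqrt (vmeas w x)) \<longlonglongrightarrow> 0"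
        using tendsto_divide[OF lim' tendsto_const[of "sqrt (vmeas w x)"]] vmeas_pos[of x] by simp
    qed
    hence "(\<lambda>N. S N x) \<longlonglongrightarrow> v' x" by (simp add: LIM_zero_iff)
    moreover have "(\<lambda>N. S N x) \<longlonglongrightarrow> v x" using sums[of x] by (simp add: sums_def S_def)
    ultimately show "v' x = v x" by (rule LIMSEQ_unique)
  qed
  have "heat_semigroup w t (indicator {y}) = v"
    unfolding heat_semigroup_def F_def[symmetric] S_def[symmetric]
  proof (rule the_equality)
    show "v \<in> ell2 (vmeas w) \<and> (\<lambda>N. ell2_norm (vmeas w) (\<lambda>x. S N x - v x)) \<longlonglongrightarrow> 0"
      by (intro conjI v lim)
  qed (elim conjE, rule unique)
  thus ?thesis by (simp add: v_def)
qed

lemma heat_kernel_sums: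
  "(\<lambda>n. walk_prob n x y * (exp (- t) * t ^ n / fact n)) sums (vmeas w y * heat_kernel w t x y)"
proof -
  have "(\<lambda>n. exp (- t) * (t ^ n / fact n * walk_prob n x y)) sums
      (exp (- t) * (\<Sum>n. t ^ n / fact n * walk_prob n x y))"
    by (intro sums_mult summable_sums summable_walk_series)
  thus ?thesis using vmeas_pos[of y]
    by (simp add: heat_kernel_def heat_semigroup_indicator mult_ac)
qed

lemma heat_kernel_sym: "heat_kernel w t x y = heat_kernel w t y x"
proof -
  have "(\<lambda>n. vmeas w x * (walk_prob n x y * (exp (- t) * t ^ n / fact n))) sums (vmeas w x * (vmeas w y * heat_kernel w t x y))"
    by (intro sums_mult heat_kernel_sums)
  moreover have "(\<lambda>n. vmeas w y * (walk_prob n y x * (exp (- t) * t ^ n / fact n))) sums (vmeas w y * (vmeas w x * heat_kernel w t y x))"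
    by (intro sums_mult heat_kernel_sums)
  moreover have "vmeas w x * (walk_prob n x y * q) = vmeas w y * (walk_prob n y x * q)" for n q
    using walk_prob_sym[of x n y] by (metis mult.assoc)
  ultimately have "vmeas w x * (vmeas w y * heat_kernel w t x y) = vmeas w y * (vmeas w x * heat_kernel w t y x)"
    by (simp add: sums_iff)
  thus ?thesis using vmeas_pos[of x] vmeas_pos[of y] by simp
qed

lemma heat_kernel_pos:
  assumes "0 < t" shows "0 < heat_kernel w t x y"
proof -
  obtain n where n: "0 < walk_prob n x y" using walk_prob_pos .
  have "0 < (\<Sum>n. walk_prob n x y * (exp (- t) * t ^ n / fact n))"
    using sums_summable[OF heat_kernel_sums] n assms
    by (intro suminf_pos2[of _ n]) (auto simp: walk_prob_nonneg)
  also have "\<dots> = vmeas w y * heat_kernel w t x y" using heat_kernel_sums by (simp add: sums_iff)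
  finally show ?thesis using vmeas_pos[of y] by (simp add: zero_less_mult_iff)
qed

section \<open>Integrating the heat kernel term by term\<close>

text \<open>All terms of the Poisson mixture are nonnegative, so the convergence of the series of integrals
  suffices for integrating term by term. Indices with \<open>walk_prob n x y = 0\<close> are exempt from the
  integrability condition: off the diagonal this covers \<open>n = 0\<close>, where the weight \<open>exp (- t)\<close> is not
  integrable against \<open>t powr (-1 - s)\<close> at \<open>0\<close>.\<close>

lemma
  assumes "I \<subseteq> {0<..}"
    and \<rho>: "\<And>t. t \<in> I \<Longrightarrow> 0 \<le> \<rho> t"
    and int: "\<And>n. walk_prob n x y \<noteq> 0 \<Longrightarrow> set_integrable lborel I (\<lambda>t. poisson n t * \<rho> t)"
    and summ: "summable (\<lambda>n. walk_prob n x y * (LINT t:I|lborel. poisson n t * \<rho> t))"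
  shows set_integrable_heat_kernel: "set_integrable lborel I (\<lambda>t. heat_kernel w t x y * \<rho> t)"
    and set_integral_heat_kernel:
      "vmeas w y * (LINT t:I|lborel. heat_kernel w t x y * \<rho> t)
         = (\<Sum>n. walk_prob n x y * (LINT t:I|lborel. poisson n t * \<rho> t))"
proof -
  define f where "f n t = walk_prob n x y * (indicator I t *\<^sub>R (poisson n t * \<rho> t))" for n t
  have f_int: "integrable lborel (f n)" for n
    using int[of n] unfolding f_def set_integrable_def by (cases "walk_prob n x y = 0") auto
  have f_nonneg: "0 \<le> f n t" for n t
    using assms(1) \<rho> walk_prob_nonneg poisson_nonneg[of t n]
    by (cases "t \<in> I") (auto simp: f_def)
  have f_sums: "(\<lambda>n. f n t) sums (vmeas w y * (indicator I t *\<^sub>R (heat_kernel w t x y * \<rho> t)))" for t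
    using sums_mult2[OF heat_kernel_sums[of x y t], of "indicator I t * \<rho> t"]
    by (simp add: f_def poisson_def mult_ac)
  have f_integral: "integral\<^sup>L lborel (f n) = walk_prob n x y * (LINT t:I|lborel. poisson n t * \<rho> t)" for n
    unfolding f_def set_lebesgue_integral_def by (rule integral_mult_right_zero)
  have ae: "AE t in lborel. summable (\<lambda>n. norm (f n t))"
    using sums_summable[OF f_sums] f_nonneg by (intro always_eventually allI) simp
  have "summable (\<lambda>n. \<integral>t. norm (f n t) \<partial>lborel)"
    using summ f_nonneg by (simp add: f_integral)
  note ser = integrable_suminf[OF f_int ae this] integral_suminf[OF f_int ae this]
  have suminf_f: "(\<Sum>n. f n t) = vmeas w y * (indicator I t *\<^sub>R (heat_kernel w t x y * \<rho> t))" for t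
    using f_sums[of t] by (rule sums_unique[symmetric])
  have "integrable lborel (\<lambda>t. inverse (vmeas w y) * (vmeas w y * (indicator I t *\<^sub>R (heat_kernel w t x y * \<rho> t))))"
    using ser(1) unfolding suminf_f by (rule integrable_mult_right)
  thus "set_integrable lborel I (\<lambda>t. heat_kernel w t x y * \<rho> t)"
    using vmeas_pos[of y] by (simp add: set_integrable_def)
  show "vmeas w y * (LINT t:I|lborel. heat_kernel w t x y * \<rho> t)
         = (\<Sum>n. walk_prob n x y * (LINT t:I|lborel. poisson n t * \<rho> t))"
    using ser(2) unfolding suminf_f f_integral by (simp add: set_lebesgue_integral_def)
qed

text \<open>Off the diagonal the term \<open>n = 0\<close> vanishes.\<close>

lemma walk_series_sums:
  assumes "x \<noteq> y" "(\<lambda>n. walk_prob (Suc n) x y * c (Suc n)) sums S"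
  shows "(\<lambda>n. walk_prob n x y * c n) sums S"
  using assms by (simp add: sums_Suc_iff[of "\<lambda>n. walk_prob n x y * c n"] walk_prob_0)

lemma summable_walk_prob_mult:
  assumes "summable c" "\<And>n. 0 \<le> c n"
  shows "summable (\<lambda>n. walk_prob (f n) x y * c n)"
proof (rule summable_comparison_test'[OF assms(1)])
  show "norm (walk_prob (f n) x y * c n) \<le> c n" if "0 \<le> n" for n
    using assms(2)[of n] walk_prob_nonneg[of "f n" x y] walk_prob_le_1[of "f n" x y]
    by (simp add: mult_left_le_one_le)
qed

text \<open>The decay turns the harmonic series into one with exponent \<open>5/4\<close>.\<close>

lemma summable_walk_prob_div: "summable (\<lambda>n. walk_prob (Suc n) x y / real (Suc n))"
proof -
  obtain C where C: "0 \<le> C" "\<And>n x. walk_prob n x y \<le> C * real (Suc n) powr (-1/4)"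
    using walk_prob_decay[of y] by blast
  show ?thesis
  proof (rule summable_comparison_test')
    have "summable (\<lambda>n. real n powr (-5/4))" by (subst summable_real_powr_iff) simp
    hence "summable (\<lambda>n. real (Suc n) powr (-5/4))" by (subst summable_Suc_iff)
    thus "summable (\<lambda>n. C * real (Suc n) powr (-5/4))" by (rule summable_mult)
    show "norm (walk_prob (Suc n) x y / real (Suc n)) \<le> C * real (Suc n) powr (-5/4)" if "0 \<le> n" for n
    proof -
      have "real (Suc (Suc n)) powr (-1/4) \<le> real (Suc n) powr (-1/4)"
        by (intro powr_mono2') auto
      hence "walk_prob (Suc n) x y \<le> C * real (Suc n) powr (-1/4)"
        using C(2)[of "Suc n" x] C(1) by (meson mult_left_mono order_trans)
      hence "walk_prob (Suc n) x y / real (Suc n) \<le> C * real (Suc n) powr (-1/4) / real (Suc n)"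
        by (rule divide_right_mono) simp
      also have "\<dots> = C * (real (Suc n) powr (-1/4) * real (Suc n) powr (-1))"
        by (simp add: powr_minus_divide)
      also have "real (Suc n) powr (-1/4) * real (Suc n) powr (-1) = real (Suc n) powr (-5/4)"
        by (simp only: powr_add[symmetric]) simp
      finally show ?thesis by (simp add: walk_prob_nonneg)
    qed
  qed
qed

lemma summable_long_coeff: "summable (\<lambda>n. walk_prob n x y * long_coeff n)"
proof (subst summable_Suc_iff[symmetric], rule summable_comparison_test'[OF summable_walk_prob_div])
  show "norm (walk_prob (Suc n) x y * long_coeff (Suc n)) \<le> walk_prob (Suc n) x y / real (Suc n)"
    if "0 \<le> n" for n
    using short_plus_long_coeff[of "Suc n"] short_coeff_nonneg[of "Suc n"] long_coeff_nonneg[of "Suc n"]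
      walk_prob_nonneg[of "Suc n" x y] mult_left_mono[of "long_coeff (Suc n)" "1 / real (Suc n)" "walk_prob (Suc n) x y"]
    by simp
qed

lemma tail_integrable: "set_integrable lborel {1<..} (\<lambda>t. heat_kernel w t x y / t)"
  and tail_kernel_eq: "tail_kernel w x y = vmeas w x * (\<Sum>n. walk_prob n x y * long_coeff n)"
proof -
  have int: "set_integrable lborel {1<..} (\<lambda>t. poisson n t * (1 / t))" for n
    using set_integrable_long[of n] by simp
  have summ: "summable (\<lambda>n. walk_prob n x y * (LINT t:{1<..}|lborel. poisson n t * (1 / t)))"
    using summable_long_coeff[of x y] by (simp add: long_coeff_def)
  have I: "{1<..} \<subseteq> {0::real<..}" by auto
  show "set_integrable lborel {1<..} (\<lambda>t. heat_kernel w t x y / t)"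
    using set_integrable_heat_kernel[OF I _ int summ] by simp
  show "tail_kernel w x y = vmeas w x * (\<Sum>n. walk_prob n x y * long_coeff n)"
    using set_integral_heat_kernel[OF I _ int summ] by (simp add: tail_kernel_def long_coeff_def)
qed

lemma log_integrable:
    "x \<noteq> y \<Longrightarrow> set_integrable lborel {0<..<1} (\<lambda>t. heat_kernel w t x y / t)"
  and log_kernel_eq:
    "x \<noteq> y \<Longrightarrow> log_kernel w x y = vmeas w x * (\<Sum>n. short_coeff (Suc n) * walk_prob (Suc n) x y)"
proof -
  assume xy: "x \<noteq> y"
  have int: "set_integrable lborel {0<..<1} (\<lambda>t. poisson n t * (1 / t))" if "walk_prob n x y \<noteq> 0" for n
    using set_integrable_short[of n] that xy by (cases n) (auto simp: walk_prob_0)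
  have "summable (\<lambda>n. walk_prob (Suc n) x y * short_coeff (Suc n))"
    by (intro summable_walk_prob_mult sums_summable[OF short_coeff_sums] short_coeff_nonneg)
  from walk_series_sums[OF xy summable_sums[OF this]]
  have short: "(\<lambda>n. walk_prob n x y * short_coeff n) sums (\<Sum>n. walk_prob (Suc n) x y * short_coeff (Suc n))" .
  hence summ: "summable (\<lambda>n. walk_prob n x y * (LINT t:{0<..<1}|lborel. poisson n t * (1 / t)))"
    by (simp add: short_coeff_def sums_iff)
  have I: "{0<..<1} \<subseteq> {0::real<..}" by auto
  show "set_integrable lborel {0<..<1} (\<lambda>t. heat_kernel w t x y / t)"
    using set_integrable_heat_kernel[OF I _ int summ] by simp
  have "vmeas w y * (LINT t:{0<..<1}|lborel. heat_kernel w t x y / t) = (\<Sum>n. walk_prob n x y * short_coeff n)"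
    using set_integral_heat_kernel[OF I _ int summ] by (simp add: short_coeff_def)
  thus "log_kernel w x y = vmeas w x * (\<Sum>n. short_coeff (Suc n) * walk_prob (Suc n) x y)"
    using sums_unique[OF short] by (simp add: log_kernel_def mult.commute)
qed

lemma frac_kernel_eq:
  assumes "0 < s" "s < 1" "x \<noteq> y"
  shows "frac_kernel w s x y = vmeas w x * (\<Sum>n. frac_coeff s n * walk_prob (Suc n) x y)"
proof -
  let ?\<rho> = "\<lambda>t::real. t powr (-1 - s)"
  let ?c = "\<lambda>n. LINT t:{0<..}|lborel. poisson n t * ?\<rho> t"
  have G: "0 < Gamma (1 - s)" using assms by (intro Gamma_real_pos) simp
  have c: "frac_coeff s n = s / Gamma (1 - s) * ?c (Suc n)" for n
    using poisson_powr_integral(2)[of s "Suc n"] assms by (simp add: frac_coeff_eq_Gamma)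
  have c': "?c (Suc n) = Gamma (1 - s) / s * frac_coeff s n" for n
    using less_imp_neq[OF G] assms by (simp add: c)
  have sum_c: "summable (\<lambda>n. ?c (Suc n))"
    unfolding c' using frac_coeff_sums[OF assms(1,2)] by (intro summable_mult) (simp add: sums_iff)
  have int: "set_integrable lborel {0<..} (\<lambda>t. poisson n t * ?\<rho> t)" if "walk_prob n x y \<noteq> 0" for n
    using poisson_powr_integral(1)[of s n] that assms by (cases n) (auto simp: walk_prob_0)
  have summ1: "summable (\<lambda>n. walk_prob (Suc n) x y * ?c (Suc n))"
    using sum_c by (rule summable_walk_prob_mult) (use G assms frac_coeff_nonneg[of s] in \<open>simp add: c'\<close>)
  note ser = walk_series_sums[OF assms(3) summable_sums[OF summ1]]
  have summ: "summable (\<lambda>n. walk_prob n x y * ?c n)" using ser by (rule sums_summable)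
  have "vmeas w y * (LINT t:{0<..}|lborel. heat_kernel w t x y * ?\<rho> t) = (\<Sum>n. walk_prob n x y * ?c n)"
    by (rule set_integral_heat_kernel[OF subset_refl _ int summ]) auto
  also have "\<dots> = (\<Sum>n. walk_prob (Suc n) x y * ?c (Suc n))"
    using ser by (rule sums_unique[symmetric])
  finally have "frac_kernel w s x y = vmeas w x * (s / Gamma (1 - s) * (\<Sum>n. walk_prob (Suc n) x y * ?c (Suc n)))"
    by (simp add: frac_kernel_def mult_ac)
  also have "s / Gamma (1 - s) * (\<Sum>n. walk_prob (Suc n) x y * ?c (Suc n)) = (\<Sum>n. frac_coeff s n * walk_prob (Suc n) x y)"
    by (subst suminf_mult[OF summ1, symmetric]) (simp add: c mult_ac)
  finally show ?thesis .
qed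

section \<open>Nonlocal operators as mixtures of walk averages\<close>

text \<open>The function \<open>P\<^sup>n u\<close> for \<open>u\<close> of finite support, written through the walk probabilities.\<close>

definition walk_mean :: "(int ^ 'd \<Rightarrow> real) \<Rightarrow> nat \<Rightarrow> int ^ 'd \<Rightarrow> real" where
  "walk_mean u n x = (\<Sum>y | u y \<noteq> 0. walk_prob n x y * u y)"

lemma walk_mean_0: "finsupp u \<Longrightarrow> walk_mean u 0 x = u x"
  by (auto simp: walk_mean_def walk_prob_0 finsupp_def if_distrib[of "\<lambda>c. c * _"] sum.delta cong: if_cong)

text \<open>A jump kernel that is a mixture of the laws of the walk acts as the same mixture of the operators
  \<open>u \<mapsto> u - P\<^sup>n u\<close>. The interchange of the sums over \<open>n\<close> and \<open>y\<close> rests on \<open>\<Sum>y. P\<^sup>n(x, y) = 1\<close>, and the term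
  \<open>y = x\<close> may be added because \<open>u x - u y\<close> vanishes there.\<close>

lemma has_sum_nonlocal:
  assumes u: "finsupp u" and a: "summable a" "\<And>n. 0 \<le> a n"
    and K: "\<And>y. y \<noteq> x \<Longrightarrow> K y = vmeas w x * (\<Sum>n. a n * walk_prob (Suc n) x y)"
  shows "((\<lambda>y. K y * (u x - u y)) has_sum (vmeas w x * (\<Sum>n. a n * (u x - walk_mean u (Suc n) x)))) (UNIV - {x})"
    and "summable (\<lambda>n. a n * walk_mean u (Suc n) x)"
proof -
  define k where "k y = (\<Sum>n. a n * walk_prob (Suc n) x y)" for y
  have k_sums: "(\<lambda>n. a n * walk_prob (Suc n) x y) sums k y" for y
    unfolding k_def using summable_walk_prob_mult[OF a, of Suc x y]
    by (intro summable_sums) (simp add: mult.commute)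
  have k_has_sum: "((\<lambda>n. a n * walk_prob (Suc n) x y) has_sum k y) UNIV" for y
    by (rule sums_nonneg_imp_has_sum[OF k_sums]) (simp add: a walk_prob_nonneg)
  have row: "((\<lambda>y. a n * walk_prob (Suc n) x y) has_sum a n) UNIV" for n
    using has_sum_cmult_right[OF walk_prob_has_sum, of "a n" "Suc n" x] by simp
  have a_sum: "(a has_sum suminf a) UNIV"
    by (rule sums_nonneg_imp_has_sum) (use a in auto)
  let ?f = "\<lambda>(n, y). a n * walk_prob (Suc n) x y"
  have "?f summable_on UNIV \<times> UNIV"
    by (rule summable_on_SigmaI[where g = a])
      (use row a a_sum walk_prob_nonneg in \<open>auto simp: has_sum_imp_summable\<close>)
  hence "(?f has_sum suminf a) (UNIV \<times> UNIV)"
    by (intro has_sum_SigmaI[where g = a]) (use row a_sum in auto)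
  hence "((\<lambda>(y, n). a n * walk_prob (Suc n) x y) has_sum suminf a) (UNIV \<times> UNIV)"
    by (subst has_sum_swap) simp
  hence k_total: "(k has_sum suminf a) UNIV"
    by (rule has_sum_SigmaD) (use k_has_sum in simp)
  have mean_sums: "(\<lambda>n. a n * walk_mean u (Suc n) x) sums (\<Sum>y | u y \<noteq> 0. k y * u y)"
    using sums_sum[of "{y. u y \<noteq> 0}" "\<lambda>y n. a n * walk_prob (Suc n) x y * u y" "\<lambda>y. k y * u y"]
    by (simp add: walk_mean_def sum_distrib_left mult.assoc sums_mult2[OF k_sums, unfolded mult.assoc])
  thus "summable (\<lambda>n. a n * walk_mean u (Suc n) x)" by (rule sums_summable)
  have "((\<lambda>y. k y * u x) has_sum (suminf a * u x)) UNIV"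
    by (rule has_sum_cmult_left[OF k_total])
  moreover have "((\<lambda>y. k y * u y) has_sum (\<Sum>y | u y \<noteq> 0. k y * u y)) UNIV"
    by (rule has_sum_finite_neutralI[of "{y. u y \<noteq> 0}"]) (use u in \<open>auto simp: finsupp_def\<close>)
  ultimately have "((\<lambda>y. k y * u x + - (k y * u y)) has_sum (suminf a * u x + - (\<Sum>y | u y \<noteq> 0. k y * u y))) UNIV"
    by (intro has_sum_add has_sum_uminusI)
  hence "((\<lambda>y. k y * u x - k y * u y) has_sum (suminf a * u x - (\<Sum>y | u y \<noteq> 0. k y * u y))) UNIV"
    by simp
  moreover have "(\<lambda>n. a n * (u x - walk_mean u (Suc n) x)) sums (suminf a * u x - (\<Sum>y | u y \<noteq> 0. k y * u y))"
    using sums_diff[OF sums_mult2[OF summable_sums[OF a(1)], of "u x"] mean_sums]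
    by (simp add: right_diff_distrib)
  ultimately have "((\<lambda>y. k y * (u x - u y)) has_sum (\<Sum>n. a n * (u x - walk_mean u (Suc n) x))) UNIV"
    by (simp add: right_diff_distrib sums_iff)
  hence "((\<lambda>y. vmeas w x * (k y * (u x - u y))) has_sum (vmeas w x * (\<Sum>n. a n * (u x - walk_mean u (Suc n) x)))) UNIV"
    by (rule has_sum_cmult_right)
  thus "((\<lambda>y. K y * (u x - u y)) has_sum (vmeas w x * (\<Sum>n. a n * (u x - walk_mean u (Suc n) x)))) (UNIV - {x})"
    by (rule has_sum_cong_neutral[THEN iffD1, rotated -1]) (auto simp: K k_def)
qed

lemma summable_walk_mean_div:
  "summable (\<lambda>n. \<bar>walk_mean u (Suc n) x\<bar> / real (Suc n))"
proof (rule summable_comparison_test')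
  show "summable (\<lambda>n. \<Sum>y | u y \<noteq> 0. \<bar>u y\<bar> * (walk_prob (Suc n) x y / real (Suc n)))"
    by (intro summable_sum summable_mult summable_walk_prob_div)
  show "norm (\<bar>walk_mean u (Suc n) x\<bar> / real (Suc n))
      \<le> (\<Sum>y | u y \<noteq> 0. \<bar>u y\<bar> * (walk_prob (Suc n) x y / real (Suc n)))" if "0 \<le> n" for n
  proof -
    have "\<bar>walk_mean u (Suc n) x\<bar> \<le> (\<Sum>y | u y \<noteq> 0. \<bar>u y\<bar> * walk_prob (Suc n) x y)"
      unfolding walk_mean_def
      by (rule order_trans[OF sum_abs]) (simp add: abs_mult walk_prob_nonneg mult.commute)
    hence "\<bar>walk_mean u (Suc n) x\<bar> / real (Suc n) \<le> (\<Sum>y | u y \<noteq> 0. \<bar>u y\<bar> * walk_prob (Suc n) x y) / real (Suc n)"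
      by (rule divide_right_mono) simp
    thus ?thesis by (simp add: sum_divide_distrib)
  qed
qed

lemma frac_laplacian_eq:
  assumes "finsupp u" "0 < s" "s < 1"
  shows "frac_laplacian w s u x = u x - (\<Sum>n. frac_coeff s n * walk_mean u (Suc n) x)"
proof -
  note c = frac_coeff_sums[OF assms(2,3)]
  have summ: "summable (frac_coeff s)" using c by (rule sums_summable)
  have nn: "0 \<le> frac_coeff s n" for n using assms by (simp add: frac_coeff_nonneg)
  note hs = has_sum_nonlocal[OF assms(1) summ nn frac_kernel_eq[OF assms(2,3) not_sym], of x]
  have "frac_laplacian w s u x = (\<Sum>n. frac_coeff s n * (u x - walk_mean u (Suc n) x))"
    using infsumI[OF hs(1)] vmeas_pos[of x] assms(2) by (simp add: frac_laplacian_def)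
  also have "\<dots> = (\<Sum>n. frac_coeff s n * u x) - (\<Sum>n. frac_coeff s n * walk_mean u (Suc n) x)"
    unfolding right_diff_distrib by (intro suminf_diff[symmetric] summable_mult2 summ hs(2))
  also have "(\<Sum>n. frac_coeff s n * u x) = u x"
    using sums_unique[OF sums_mult2[OF c, of "u x"]] by simp
  finally show ?thesis .
qed

text \<open>The coefficients \<open>frac_coeff s n / s\<close> are dominated by \<open>1 / Suc n\<close>, their limit at \<open>s = 0\<close>; the
  decay of the walk makes the dominating series converge, and Tannery's theorem applies.\<close>

lemma frac_laplacian_derivative:
  assumes u: "finsupp u"
  shows "((\<lambda>s. (frac_laplacian w s u x - u x) / s) \<longlongrightarrow> - (\<Sum>n. walk_mean u (Suc n) x / real (Suc n))) (at_right 0)"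
proof -
  have ev: "\<forall>\<^sub>F s in at_right (0::real). 0 < s \<and> s < 1"
    using eventually_at_right_less[of "0::real"] eventually_at_right_field[of _ "0::real"]
    by (auto simp: eventually_at_right_field intro: exI[of _ 1])
  have "((\<lambda>s. \<Sum>n. frac_coeff s n / s * walk_mean u (Suc n) x) \<longlongrightarrow> (\<Sum>n. 1 / real (Suc n) * walk_mean u (Suc n) x)) (at_right 0)"
  proof (rule tannerys_theorem[where M = "\<lambda>n. \<bar>walk_mean u (Suc n) x\<bar> / real (Suc n)", THEN conjunct2, THEN conjunct2])
    show "((\<lambda>s. frac_coeff s n / s * walk_mean u (Suc n) x) \<longlongrightarrow> 1 / real (Suc n) * walk_mean u (Suc n) x) (at_right 0)" for n
      by (intro tendsto_mult frac_coeff_div_tendsto tendsto_const)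
    have "\<forall>\<^sub>F (n::nat, s) in at_top \<times>\<^sub>F at_right (0::real). 0 < s \<and> s < 1"
      using ev by (subst eventually_prod2) auto
    thus "\<forall>\<^sub>F (n, s) in at_top \<times>\<^sub>F at_right 0.
        norm (frac_coeff s n / s * walk_mean u (Suc n) x) \<le> \<bar>walk_mean u (Suc n) x\<bar> / real (Suc n)"
    proof (rule eventually_mono, clarify)
      fix n and s :: real assume s: "0 < s" "s < 1"
      have "frac_coeff s n / s * \<bar>walk_mean u (Suc n) x\<bar> \<le> 1 / real (Suc n) * \<bar>walk_mean u (Suc n) x\<bar>"
        by (intro mult_right_mono frac_coeff_div_le s) simp
      thus "norm (frac_coeff s n / s * walk_mean u (Suc n) x) \<le> \<bar>walk_mean u (Suc n) x\<bar> / real (Suc n)"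
        using s frac_coeff_nonneg[of s n] by (simp add: abs_mult)
    qed
  qed (rule summable_walk_mean_div, simp)
  hence "((\<lambda>s. - (\<Sum>n. frac_coeff s n / s * walk_mean u (Suc n) x)) \<longlongrightarrow> - (\<Sum>n. walk_mean u (Suc n) x / real (Suc n))) (at_right 0)"
    by (intro tendsto_minus) simp
  moreover have "\<forall>\<^sub>F s in at_right 0. - (\<Sum>n. frac_coeff s n / s * walk_mean u (Suc n) x) = (frac_laplacian w s u x - u x) / s"
    using ev
  proof eventually_elim
    case (elim s)
    have "summable (\<lambda>n. frac_coeff s n * walk_mean u (Suc n) x)"
    proof (rule summable_comparison_test'[OF summable_mult[OF summable_walk_mean_div, of s u x]])
      show "norm (frac_coeff s n * walk_mean u (Suc n) x) \<le> s * (\<bar>walk_mean u (Suc n) x\<bar> / real (Suc n))" if "0 \<le> n" for n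
      proof -
        have "frac_coeff s n \<le> s / real (Suc n)"
          using frac_coeff_div_le[of s n] elim by (simp add: divide_simps)
        from mult_right_mono[OF this, of "\<bar>walk_mean u (Suc n) x\<bar>"] show ?thesis
          using elim frac_coeff_nonneg[of s n] by (simp add: abs_mult)
      qed
    qed
    from suminf_divide[OF this, of s] show ?case
      using elim by (simp add: frac_laplacian_eq[OF u])
  qed
  ultimately show ?thesis by (rule Lim_transform_eventually)
qed

lemma log_laplacian_eq:
  assumes u: "finsupp u"
  shows "log_laplacian w u x = - (\<Sum>n. walk_mean u (Suc n) x / real (Suc n))"
  unfolding log_laplacian_def
  by (rule tendsto_Lim[OF _ frac_laplacian_derivative[OF u]]) simp

lemma
  assumes u: "finsupp u"
  shows log_kernel_has_sum: "((\<lambda>y. log_kernel w x y * (u x - u y)) has_sum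
      vmeas w x * (\<Sum>n. short_coeff (Suc n) * (u x - walk_mean u (Suc n) x))) (UNIV - {x})"
    and summable_short_mean: "summable (\<lambda>n. short_coeff (Suc n) * walk_mean u (Suc n) x)"
  by (rule has_sum_nonlocal[OF u _ _ log_kernel_eq[OF not_sym]];
      use short_coeff_sums short_coeff_nonneg in \<open>auto simp: sums_iff\<close>)+

lemma
  assumes u: "finsupp u"
  shows tail_kernel_infsum: "(\<Sum>\<^sub>\<infinity>y. tail_kernel w x y * u y) = vmeas w x * (\<Sum>n. long_coeff n * walk_mean u n x)"
    and summable_long_mean: "summable (\<lambda>n. long_coeff n * walk_mean u n x)"
proof -
  let ?k = "\<lambda>y. \<Sum>n. walk_prob n x y * long_coeff n"
  have "(\<lambda>n. \<Sum>y | u y \<noteq> 0. walk_prob n x y * long_coeff n * u y) sums (\<Sum>y | u y \<noteq> 0. ?k y * u y)"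
    by (intro sums_sum sums_mult2 summable_sums summable_long_coeff)
  moreover have "(\<Sum>y | u y \<noteq> 0. walk_prob n x y * long_coeff n * u y) = long_coeff n * walk_mean u n x" for n
    by (simp add: walk_mean_def sum_distrib_left mult_ac)
  ultimately have *: "(\<lambda>n. long_coeff n * walk_mean u n x) sums (\<Sum>y | u y \<noteq> 0. ?k y * u y)" by simp
  thus "summable (\<lambda>n. long_coeff n * walk_mean u n x)" by (rule sums_summable)
  have "((\<lambda>y. tail_kernel w x y * u y) has_sum (\<Sum>y | u y \<noteq> 0. tail_kernel w x y * u y)) UNIV"
    by (rule has_sum_finite_neutralI[of "{y. u y \<noteq> 0}"]) (use u in \<open>auto simp: finsupp_def\<close>)
  hence "(\<Sum>\<^sub>\<infinity>y. tail_kernel w x y * u y) = vmeas w x * (\<Sum>y | u y \<noteq> 0. ?k y * u y)"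
    by (simp add: infsumI tail_kernel_eq sum_distrib_left mult.assoc)
  thus "(\<Sum>\<^sub>\<infinity>y. tail_kernel w x y * u y) = vmeas w x * (\<Sum>n. long_coeff n * walk_mean u n x)"
    using * by (simp add: sums_iff)
qed

text \<open>The two coefficient sequences add up to \<open>1 / n\<close> for \<open>n \<ge> 1\<close>; the remaining multiples of \<open>u x\<close> are those
  in \<open>deriv_Gamma_1\<close> and cancel against \<open>\<Gamma>'(1)\<close>.\<close>

lemma log_laplacian_formula:
  assumes u: "finsupp u"
  shows "log_laplacian w u x =
     (1 / vmeas w x) * (\<Sum>\<^sub>\<infinity>y\<in>UNIV - {x}. log_kernel w x y * (u x - u y))
       - (1 / vmeas w x) * (\<Sum>\<^sub>\<infinity>y. tail_kernel w x y * u y) + deriv Gamma 1 * u x"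
proof -
  define U where "U n = walk_mean u n x" for n
  let ?S = "\<Sum>n. short_coeff (Suc n)"
  have short: "summable (\<lambda>n. short_coeff (Suc n))" using short_coeff_sums by (rule sums_summable)
  note shortU = summable_short_mean[OF u, of x, folded U_def]
  note longU = summable_long_mean[OF u, of x, folded U_def]
  have longU': "summable (\<lambda>n. long_coeff (Suc n) * U (Suc n))"
    using longU by (subst summable_Suc_iff)
  have "(1 / vmeas w x) * (\<Sum>\<^sub>\<infinity>y\<in>UNIV - {x}. log_kernel w x y * (u x - u y))
      = (\<Sum>n. short_coeff (Suc n) * (u x - U (Suc n)))"
    using infsumI[OF log_kernel_has_sum[OF u, of x]] vmeas_pos[of x] by (simp add: U_def)
  also have "\<dots> = (\<Sum>n. short_coeff (Suc n) * u x) - (\<Sum>n. short_coeff (Suc n) * U (Suc n))"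
    unfolding right_diff_distrib by (intro suminf_diff[symmetric] summable_mult2 short shortU)
  also have "(\<Sum>n. short_coeff (Suc n) * u x) = ?S * u x"
    by (rule suminf_mult2[OF short, symmetric])
  finally have 1: "(1 / vmeas w x) * (\<Sum>\<^sub>\<infinity>y\<in>UNIV - {x}. log_kernel w x y * (u x - u y))
      = ?S * u x - (\<Sum>n. short_coeff (Suc n) * U (Suc n))" .
  have "(1 / vmeas w x) * (\<Sum>\<^sub>\<infinity>y. tail_kernel w x y * u y) = (\<Sum>n. long_coeff n * U n)"
    using vmeas_pos[of x] by (simp add: tail_kernel_infsum[OF u] U_def)
  also have "\<dots> = long_coeff 0 * u x + (\<Sum>n. long_coeff (Suc n) * U (Suc n))"
    using suminf_split_head[OF longU] walk_mean_0[OF u] by (simp add: U_def)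
  finally have 2: "(1 / vmeas w x) * (\<Sum>\<^sub>\<infinity>y. tail_kernel w x y * u y)
      = long_coeff 0 * u x + (\<Sum>n. long_coeff (Suc n) * U (Suc n))" .
  have "(\<Sum>n. U (Suc n) / real (Suc n)) = (\<Sum>n. short_coeff (Suc n) * U (Suc n) + long_coeff (Suc n) * U (Suc n))"
    using short_plus_long_coeff[of "Suc n" for n]
    by (intro suminf_cong) (simp add: distrib_right[symmetric])
  also have "\<dots> = (\<Sum>n. short_coeff (Suc n) * U (Suc n)) + (\<Sum>n. long_coeff (Suc n) * U (Suc n))"
    by (rule suminf_add[OF shortU longU', symmetric])
  finally show ?thesis
    unfolding 1 2 log_laplacian_eq[OF u] deriv_Gamma_1 by (simp add: U_def algebra_simps)
qed

lemma log_kernel_sym: "log_kernel w x y = log_kernel w y x"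
  by (simp add: log_kernel_def heat_kernel_sym[of _ x] mult.commute)

lemma tail_kernel_sym: "tail_kernel w x y = tail_kernel w y x"
  by (simp add: tail_kernel_def heat_kernel_sym[of _ x] mult.commute)

lemma log_kernel_pos: "x \<noteq> y \<Longrightarrow> 0 < log_kernel w x y"
  unfolding log_kernel_def
  by (intro mult_pos_pos vmeas_pos set_integral_pos log_integrable) (auto simp: heat_kernel_pos)

lemma tail_kernel_pos: "0 < tail_kernel w x y"
  unfolding tail_kernel_def
proof (intro mult_pos_pos vmeas_pos set_integral_pos tail_integrable)
  have "emeasure lborel {1<..<2::real} \<le> emeasure lborel {1::real<..}" by (intro emeasure_mono) auto
  thus "emeasure lborel {1::real<..} \<noteq> 0" by auto
qed (auto simp: heat_kernel_pos)

end

theorem theorem4p12: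
  fixes w :: "int ^ 'd::finite \<Rightarrow> int ^ 'd \<Rightarrow> real"
    and u :: "int ^ 'd \<Rightarrow> real"
  assumes "lattice_weight w"
    and "0 < vmeas_min w" and "vmeas_min w \<le> vmeas_max w" and "vmeas_max w < \<infinity>"
    and "0 < weight_inf w"
    and "finite {x. u x \<noteq> 0}"
  shows "(\<forall>x.
            ((\<lambda>s. (frac_laplacian w s u x - u x) / s) \<longlongrightarrow> log_laplacian w u x) (at_right 0) \<and>
            (\<lambda>y. log_kernel w x y * (u x - u y)) summable_on (UNIV - {x}) \<and>
            log_laplacian w u x =
              (1 / vmeas w x) * (\<Sum>\<^sub>\<infinity>y\<in>UNIV - {x}. log_kernel w x y * (u x - u y))
              - (1 / vmeas w x) * (\<Sum>\<^sub>\<infinity>y. tail_kernel w x y * u y)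
              + deriv Gamma 1 * u x) \<and>
         (\<forall>x y. x \<noteq> y \<longrightarrow>
            set_integrable lborel {0<..<1} (\<lambda>t. heat_kernel w t x y / t) \<and>
            log_kernel w x y = log_kernel w y x \<and> 0 < log_kernel w x y) \<and>
         (\<forall>x y.
            set_integrable lborel {1<..} (\<lambda>t. heat_kernel w t x y / t) \<and>
            tail_kernel w x y = tail_kernel w y x \<and> 0 < tail_kernel w x y)"
proof -
  interpret lattice_walk w using assms by unfold_locales
  have u: "finsupp u" using assms by (simp add: finsupp_def)
  show ?thesis
    using frac_laplacian_derivative[OF u] log_laplacian_eq[OF u]
      has_sum_imp_summable[OF log_kernel_has_sum[OF u]] log_laplacian_formula[OF u]
      log_integrable log_kernel_sym log_kernel_pos tail_integrable tail_kernel_sym tail_kernel_pos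
    by (intro conjI allI impI) (simp_all only:)
qed

end
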